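(* Let $r\geq 2$ and $n\geq 2r+1$ be integers, let $0<a<\pi/2$, and let $\varphi_a:B^n\to\mathbb{S}^n$ be the map $\varphi_a(x)=\left(\sin a\,\frac{x}{|x|},\,\cos a\right)$. Then $\varphi_a$ is weakly $r$-harmonic if and only if it is weakly $ES$-$r$-harmonic.
   Context: $B^n\subset\mathbb{R}^n$ is the Euclidean unit ball with centre $O$ and $\mathbb{S}^n\subset\mathbb{R}^n\times\mathbb{R}$ the Euclidean unit sphere. $\varphi_a$ is smooth away from $O$. For a smooth map $\varphi:(M,g_M)\to(N,g_N)$ of Riemannian manifolds, $m=\dim M$, $\tau(\varphi)=-d^*d\varphi=\mathrm{trace}_{g_M}\nabla d\varphi$ is the tension field, a section of $\varphi^{-1}TN$; $d,d^*$ denote exterior covariant differentiation and codifferential on $\varphi^{-1}TN$-valued forms ($d^*$ vanishes on $0$-forms). The rough Laplacian on sections of $\varphi^{-1}TN$ is $\overline{\Delta}=d^*d=-\sum_{i=1}^m\left(\nabla^\varphi_{e_i}\nabla^\varphi_{e_i}-\nabla^\varphi_{\nabla^M_{e_i}e_i}\right)$, $\{e_i\}$ a local orthonormal frame. The $r$-energy is $E_{2s}(\varphi)=\frac12\int_M|\overline{\Delta}^{s-1}\tau(\varphi)|^2\,dV$ and $E_{2s+1}(\varphi)=\frac12\int_M\sum_{j=1}^m|\nabla^\varphi_{e_j}\overline{\Delta}^{s-1}\tau(\varphi)|^2\,dV$ ($s\ge1$). The $ES$-$r$-energy is $E_r^{ES}(\varphi)=\frac12\int_M|(d^*+d)^r(\varphi)|^2\,dV$,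 where $(d^*+d)\varphi=d\varphi$, $(d^*+d)^2\varphi=-\tau(\varphi)$ and $(d^*+d)^r\varphi=-(d^*+d)^{r-2}\tau(\varphi)$ for $r\geq 3$. A smooth map is $r$-harmonic ($ES$-$r$-harmonic) if it is a critical point of $E_r$ ($E_r^{ES}$). $W^{r,2}(B^n,\mathbb{S}^n)$ is the set of $\varphi\in W^{r,2}(B^n,\mathbb{R}^{n+1})$ with $\varphi(x)\in\mathbb{S}^n$ a.e. A map is weakly $r$-harmonic (weakly $ES$-$r$-harmonic) if it belongs to $W^{r,2}(B^n,\mathbb{S}^n)$ and solves the Euler-Lagrange equation of $E_r$ ($E_r^{ES}$) in the sense of distributions. For the maps $\varphi_a$ this is used in the equivalent form: $\varphi_a\in W^{r,2}(B^n,\mathbb{S}^n)$ and $\varphi_a$ is $r$-harmonic ($ES$-$r$-harmonic) on $B^n\setminus\{O\}$. *)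

theory Defs
  imports "HOL-Analysis.Analysis"
begin

section \<open>Smooth functions\<close>

text \<open>\<open>C\<^sup>k\<close> functions on an open set \<open>S\<close>.\<close>

primrec Ck_on :: "nat \<Rightarrow> 'a::euclidean_space set \<Rightarrow> ('a \<Rightarrow> 'b::euclidean_space) \<Rightarrow> bool" where
  "Ck_on 0 S f \<longleftrightarrow> continuous_on S f"
| "Ck_on (Suc k) S f \<longleftrightarrow>
     (\<forall>x\<in>S. f differentiable (at x)) \<and> (\<forall>v. Ck_on k S (\<lambda>x. frechet_derivative f (at x) v))"

definition smooth_on :: "'a::euclidean_space set \<Rightarrow> ('a \<Rightarrow> 'b::euclidean_space) \<Rightarrow> bool" where
  "smooth_on S f \<longleftrightarrow> (\<forall>k. Ck_on k S f)"

section \<open>Calculus along maps from a flat domain into the unit sphere\<close>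

text \<open>
  The domain is an open subset of a Euclidean space with its flat metric, the target is the
  unit sphere \<open>sphere 0 1\<close> of a Euclidean space. A section of \<open>\<phi>\<^sup>-\<^sup>1TN\<close> is represented by a
  function \<open>V\<close> into the ambient space with \<open>V x\<close> orthogonal to \<open>\<phi> x\<close>. The pull-back
  connection is the ambient derivative followed by the orthogonal projection onto the tangent
  space of the sphere. The vectors of \<open>Basis\<close> form a global parallel orthonormal frame of the
  domain, so that every term containing \<open>\<nabla>\<^sup>M e\<^sub>i\<close> vanishes.
\<close>

definition nabla :: "('a::euclidean_space \<Rightarrow> 'b::euclidean_space) \<Rightarrow> 'a \<Rightarrow> ('a \<Rightarrow> 'b) \<Rightarrow> 'a \<Rightarrow> 'b" where
  "nabla \<phi> v V x =
     (let D = frechet_derivative V (at x) v in D - (D \<bullet> \<phi> x) *\<^sub>R \<phi> x)"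

definition tension :: "('a::euclidean_space \<Rightarrow> 'b::euclidean_space) \<Rightarrow> 'a \<Rightarrow> 'b" where
  "tension \<phi> x = (\<Sum>e\<in>Basis. nabla \<phi> e (\<lambda>y. frechet_derivative \<phi> (at y) e) x)"

definition rough_laplacian ::
    "('a::euclidean_space \<Rightarrow> 'b::euclidean_space) \<Rightarrow> ('a \<Rightarrow> 'b) \<Rightarrow> 'a \<Rightarrow> 'b" where
  "rough_laplacian \<phi> V x = - (\<Sum>e\<in>Basis. nabla \<phi> e (nabla \<phi> e V) x)"

text \<open>
  A \<open>\<phi>\<^sup>-\<^sup>1TN\<close>-valued differential form, possibly of mixed degree, is represented by a function
  \<open>\<omega>\<close>: the value of its component of degree \<open>k\<close> at the point \<open>x\<close> on the vectors
  \<open>v\<^sub>1, \<dots>, v\<^sub>k\<close> is \<open>\<omega> x [v\<^sub>1, \<dots>, v\<^sub>k]\<close>. Sections are forms concentrated on the empty list.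
\<close>

type_synonym ('a, 'b) vform = "'a \<Rightarrow> 'a list \<Rightarrow> 'b"

definition form_of_section :: "('a \<Rightarrow> 'b::euclidean_space) \<Rightarrow> ('a, 'b) vform" where
  "form_of_section V x vs = (if vs = [] then V x else 0)"

definition differential_form :: "('a::euclidean_space \<Rightarrow> 'b::euclidean_space) \<Rightarrow> ('a, 'b) vform" where
  "differential_form \<phi> x vs = (if length vs = 1 then frechet_derivative \<phi> (at x) (hd vs) else 0)"

text \<open>
  \<open>(d\<omega>)(v\<^sub>0, \<dots>, v\<^sub>k) = \<Sum>\<^sub>i (-1)\<^sup>i (\<nabla>\<^bsub>v\<^sub>i\<^esub> \<omega>)(\<dots>, v\<^sub>i omitted, \<dots>)\<close> and
  \<open>(d\<^sup>*\<omega>)(v\<^sub>2, \<dots>, v\<^sub>k) = - \<Sum>\<^sub>e (\<nabla>\<^sub>e \<omega>)(e, v\<^sub>2, \<dots>, v\<^sub>k)\<close>, acting on all degrees at once; the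
  arguments are constant vector fields.
\<close>

definition ext_d ::
    "('a::euclidean_space \<Rightarrow> 'b::euclidean_space) \<Rightarrow> ('a, 'b) vform \<Rightarrow> ('a, 'b) vform" where
  "ext_d \<phi> \<omega> x vs =
     (\<Sum>i<length vs. (- 1) ^ i *\<^sub>R
        nabla \<phi> (vs ! i) (\<lambda>y. \<omega> y (take i vs @ drop (Suc i) vs)) x)"

definition codiff ::
    "('a::euclidean_space \<Rightarrow> 'b::euclidean_space) \<Rightarrow> ('a, 'b) vform \<Rightarrow> ('a, 'b) vform" where
  "codiff \<phi> \<omega> x vs = - (\<Sum>e\<in>Basis. nabla \<phi> e (\<lambda>y. \<omega> y (e # vs)) x)"

definition dirac ::
    "('a::euclidean_space \<Rightarrow> 'b::euclidean_space) \<Rightarrow> ('a, 'b) vform \<Rightarrow> ('a, 'b) vform" where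
  "dirac \<phi> \<omega> = (\<lambda>x vs. codiff \<phi> \<omega> x vs + ext_d \<phi> \<omega> x vs)"

text \<open>
  The pointwise squared norm of an alternating form: the factor \<open>1/k!\<close> turns the sum over all
  \<open>k\<close>-tuples of basis vectors into the sum over the \<open>k\<close>-element subsets. Components of
  different degree are orthogonal to each other.
\<close>

definition form_norm_sq :: "('a::euclidean_space list \<Rightarrow> 'b::euclidean_space) \<Rightarrow> real" where
  "form_norm_sq w =
     (\<Sum>vs\<in>{vs. set vs \<subseteq> Basis \<and> length vs \<le> DIM('a)}. (norm (w vs))\<^sup>2 / fact (length vs))"

text \<open>\<open>(d\<^sup>* + d)\<^sup>r \<phi>\<close>, for \<open>r \<ge> 1\<close>.\<close>

definition dirac_pow ::
    "nat \<Rightarrow> ('a::euclidean_space \<Rightarrow> 'b::euclidean_space) \<Rightarrow> ('a, 'b) vform" where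
  "dirac_pow r \<phi> =
     (if r = 1 then differential_form \<phi>
      else (\<lambda>x vs. - ((dirac \<phi> ^^ (r - 2)) (form_of_section (tension \<phi>)) x vs)))"

section \<open>The energies and their critical points\<close>

text \<open>
  The energies are taken over a compact part \<open>K\<close> of the domain. In \<open>r_energy\<close>, \<open>r \<ge> 2\<close> is
  \<open>2s\<close> or \<open>2s + 1\<close> with \<open>s = r div 2 \<ge> 1\<close>.
\<close>

definition r_energy ::
    "nat \<Rightarrow> 'a::euclidean_space set \<Rightarrow> ('a \<Rightarrow> 'b::euclidean_space) \<Rightarrow> real" where
  "r_energy r K \<phi> =
     (let V = (rough_laplacian \<phi> ^^ (r div 2 - 1)) (tension \<phi>) in
      if even r then 1 / 2 * (LINT x:K|lborel. (norm (V x))\<^sup>2)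
      else 1 / 2 * (LINT x:K|lborel. (\<Sum>e\<in>Basis. (norm (nabla \<phi> e V x))\<^sup>2)))"

definition ES_r_energy ::
    "nat \<Rightarrow> 'a::euclidean_space set \<Rightarrow> ('a \<Rightarrow> 'b::euclidean_space) \<Rightarrow> real" where
  "ES_r_energy r K \<phi> = 1 / 2 * (LINT x:K|lborel. form_norm_sq (dirac_pow r \<phi> x))"

text \<open>
  Smooth variations \<open>\<Phi> t\<close>, \<open>\<bar>t\<bar> < \<epsilon>\<close>, of \<open>\<phi>\<close> through maps into the sphere, with support in \<open>K\<close>.
\<close>

definition sphere_variation ::
    "'a::euclidean_space set \<Rightarrow> 'a set \<Rightarrow> ('a \<Rightarrow> 'b::euclidean_space) \<Rightarrow> real \<Rightarrow>
     (real \<Rightarrow> 'a \<Rightarrow> 'b) \<Rightarrow> bool" where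
  "sphere_variation \<Omega> K \<phi> \<epsilon> \<Phi> \<longleftrightarrow>
     0 < \<epsilon> \<and> compact K \<and> K \<subseteq> \<Omega> \<and>
     smooth_on ({-\<epsilon><..<\<epsilon>} \<times> \<Omega>) (\<lambda>(t, x). \<Phi> t x) \<and>
     (\<forall>t\<in>{-\<epsilon><..<\<epsilon>}. \<forall>x\<in>\<Omega>. \<Phi> t x \<in> sphere 0 1) \<and>
     (\<forall>x\<in>\<Omega>. \<Phi> 0 x = \<phi> x) \<and>
     (\<forall>t\<in>{-\<epsilon><..<\<epsilon>}. \<forall>x\<in>\<Omega> - K. \<Phi> t x = \<phi> x)"

text \<open>
  Smooth critical points on \<open>\<Omega>\<close> of an energy functional \<open>E\<close>, where \<open>E K \<psi>\<close> is the energy of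
  \<open>\<psi>\<close> on \<open>K\<close>. Outside of \<open>K\<close> the energy density does not change along the variation, so that
  only the energy on \<open>K\<close> matters, also when the total energy is infinite.
\<close>

definition critical_point ::
    "'a::euclidean_space set \<Rightarrow> ('a set \<Rightarrow> ('a \<Rightarrow> 'b::euclidean_space) \<Rightarrow> real) \<Rightarrow>
     ('a \<Rightarrow> 'b) \<Rightarrow> bool" where
  "critical_point \<Omega> E \<phi> \<longleftrightarrow>
     smooth_on \<Omega> \<phi> \<and> \<phi> ` \<Omega> \<subseteq> sphere 0 1 \<and>
     (\<forall>K \<epsilon> \<Phi>. sphere_variation \<Omega> K \<phi> \<epsilon> \<Phi> \<longrightarrow>
        ((\<lambda>t. E K (\<Phi> t)) has_real_derivative 0) (at 0))"

definition r_harmonic_on ::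
    "nat \<Rightarrow> 'a::euclidean_space set \<Rightarrow> ('a \<Rightarrow> 'b::euclidean_space) \<Rightarrow> bool" where
  "r_harmonic_on r \<Omega> \<phi> \<longleftrightarrow> critical_point \<Omega> (r_energy r) \<phi>"

definition ES_r_harmonic_on ::
    "nat \<Rightarrow> 'a::euclidean_space set \<Rightarrow> ('a \<Rightarrow> 'b::euclidean_space) \<Rightarrow> bool" where
  "ES_r_harmonic_on r \<Omega> \<phi> \<longleftrightarrow> critical_point \<Omega> (ES_r_energy r) \<phi>"

section \<open>Sobolev maps\<close>

definition test_function :: "'a::euclidean_space set \<Rightarrow> ('a \<Rightarrow> real) \<Rightarrow> bool" where
  "test_function \<Omega> \<psi> \<longleftrightarrow>
     smooth_on UNIV \<psi> \<and> (\<exists>K. compact K \<and> K \<subseteq> \<Omega> \<and> (\<forall>x. x \<notin> K \<longrightarrow> \<psi> x = 0))"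

primrec partials ::
    "'a::euclidean_space list \<Rightarrow> ('a \<Rightarrow> 'b::euclidean_space) \<Rightarrow> 'a \<Rightarrow> 'b" where
  "partials [] f = f"
| "partials (v # vs) f = (\<lambda>x. frechet_derivative (partials vs f) (at x) v)"

definition L2_on :: "'a::euclidean_space set \<Rightarrow> ('a \<Rightarrow> 'b::euclidean_space) \<Rightarrow> bool" where
  "L2_on \<Omega> f \<longleftrightarrow>
     set_borel_measurable lebesgue \<Omega> f \<and> set_integrable lebesgue \<Omega> (\<lambda>x. (norm (f x))\<^sup>2)"

definition weak_partial ::
    "'a::euclidean_space set \<Rightarrow> 'a list \<Rightarrow> ('a \<Rightarrow> 'b::euclidean_space) \<Rightarrow> ('a \<Rightarrow> 'b) \<Rightarrow> bool" where
  "weak_partial \<Omega> vs f g \<longleftrightarrow>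
     (\<forall>\<psi>. test_function \<Omega> \<psi> \<longrightarrow>
        (LINT x:\<Omega>|lebesgue. partials vs \<psi> x *\<^sub>R f x) =
        (- 1) ^ length vs *\<^sub>R (LINT x:\<Omega>|lebesgue. \<psi> x *\<^sub>R g x))"

text \<open>\<open>W\<^sup>k\<^sup>,\<^sup>2(\<Omega>)\<close>; a multi-index is given as a list of basis vectors.\<close>

definition sobolev2 :: "nat \<Rightarrow> 'a::euclidean_space set \<Rightarrow> ('a \<Rightarrow> 'b::euclidean_space) set" where
  "sobolev2 k \<Omega> =
     {f. L2_on \<Omega> f \<and>
         (\<forall>vs. set vs \<subseteq> Basis \<and> length vs \<le> k \<longrightarrow> (\<exists>g. L2_on \<Omega> g \<and> weak_partial \<Omega> vs f g))}"

definition sobolev2_sphere :: "nat \<Rightarrow> 'a::euclidean_space set \<Rightarrow> ('a \<Rightarrow> 'b::euclidean_space) set" where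
  "sobolev2_sphere k \<Omega> =
     {f \<in> sobolev2 k \<Omega>. AE x in lebesgue. x \<in> \<Omega> \<longrightarrow> f x \<in> sphere 0 1}"

section \<open>Weak harmonicity on the unit ball\<close>

text \<open>
  Weak harmonicity of maps of the unit ball that are smooth away from the centre: Sobolev
  regularity together with harmonicity off the centre. For the maps \<open>\<phi>\<^sub>a\<close> this is the form of
  the distributional Euler-Lagrange equation that is used.
\<close>

definition weakly_r_harmonic :: "nat \<Rightarrow> ('a::euclidean_space \<Rightarrow> 'b::euclidean_space) \<Rightarrow> bool" where
  "weakly_r_harmonic r \<phi> \<longleftrightarrow>
     \<phi> \<in> sobolev2_sphere r (ball 0 1) \<and> r_harmonic_on r (ball 0 1 - {0}) \<phi>"

definition weakly_ES_r_harmonic :: "nat \<Rightarrow> ('a::euclidean_space \<Rightarrow> 'b::euclidean_space) \<Rightarrow> bool" where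
  "weakly_ES_r_harmonic r \<phi> \<longleftrightarrow>
     \<phi> \<in> sobolev2_sphere r (ball 0 1) \<and> ES_r_harmonic_on r (ball 0 1 - {0}) \<phi>"

text \<open>The value at the centre, \<open>(0, cos a)\<close> by \<open>inverse 0 = 0\<close>, is irrelevant.\<close>

definition phi_map :: "real \<Rightarrow> real ^ 'n::finite \<Rightarrow> (real ^ 'n) \<times> real" where
  "phi_map a x = (sin a *\<^sub>R (x /\<^sub>R norm x), cos a)"

end

theory Submission
  imports Defs
begin

text \<open>
  The Sobolev condition is common to both notions, so the point is to compare critical points
  away from the centre. The two energies differ because \<open>D = d\<^sup>* + d\<close> does not square to the
  Laplacian: on a section, \<open>D\<^sup>2V\<close> is the rough Laplacian of \<open>V\<close> plus the curvature term \<open>d\<^sup>2V\<close>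
  (\<open>dirac_dirac_section\<close>). Write \<open>\<Delta>\<close> for the rough Laplacian. Along a variation \<open>\<Phi> t\<close> one gets
  \<open>D\<^bsup>2k\<^esup>\<tau> = \<Delta>\<^sup>k\<tau> + R\<^sub>k\<close> with \<open>R\<^bsub>k+1\<^esub> = D\<^sup>2R\<^sub>k + d\<^sup>2\<Delta>\<^sup>k\<tau>\<close>.

  Suppose that the curvature term of every \<open>\<Delta>\<^sup>k\<tau>(\<phi>)\<close> vanishes for the initial map \<open>\<phi>\<close>. Then
  \<open>R\<^sub>k\<close> is zero at time zero, its squared norm has no first variation, and the energies differ to
  first order only by the integral of \<open>\<langle>\<Delta>\<^sup>k\<tau>, R\<^sub>k\<rangle>\<close> (for odd \<open>r\<close>, of \<open>\<langle>d\<Delta>\<^sup>k\<tau>, DR\<^sub>k\<rangle>\<close>).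
  The operator \<open>D\<close> can be moved to the left factor by partial integration. This
  lowers \<open>k\<close>, and the error is an integral of \<open>\<langle>d\<^sup>2\<sigma>, \<gamma>\<rangle>\<close> for a section \<open>\<sigma>\<close> and an alternating form
  \<open>\<gamma>\<close> such that \<open>d\<^sup>2\<sigma>\<close> and \<open>\<gamma>\<close> vanish at time zero, thus quadratic in the time
  (\<open>pairing_dirac_degree_1\<close>, \<open>pairing_dirac_degree_1_deriv_zero\<close>). At the end there remains the
  degree zero part of the two-form \<open>d\<^sup>2\<Delta>\<^sup>j\<tau>\<close>, which is zero. So the two energies have the same critical
  points (\<open>r_harmonic_on_iff_ES_r_harmonic_on\<close>).

  The image of \<open>\<phi>\<^sub>a\<close> lies in a parallel hypersphere. Each \<open>\<Delta>\<^sup>k\<tau>(\<phi>\<^sub>a)\<close> is a constant times a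
  power of \<open>|x|\<close> times the unit normal of this hypersphere in the sphere, hence orthogonal to
  the image of \<open>d\<phi>\<^sub>a\<close>, and the curvature term vanishes
  (\<open>rough_laplacian_funpow_tension_radial_field\<close>, \<open>nabla_commute_radial_field\<close>).
\<close>

section \<open>Smooth functions on open sets\<close>

lemma frechet_derivative_cong_open:
  assumes "open S" "x \<in> S" "\<And>y. y \<in> S \<Longrightarrow> f y = g y"
  shows "frechet_derivative f (at x) = frechet_derivative g (at x)"
proof -
  have "(f has_derivative D) (at x) \<longleftrightarrow> (g has_derivative D) (at x)" for D
    using has_derivative_transform_within_open[OF _ assms(1,2)] assms(3) by metis
  then show ?thesis
    unfolding frechet_derivative_def by simp
qed

lemma differentiable_cong_open:
  assumes "open S" "x \<in> S" "\<And>y. y \<in> S \<Longrightarrow> f y = g y"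
  shows "f differentiable (at x) \<longleftrightarrow> g differentiable (at x)"
  unfolding differentiable_def
  using has_derivative_transform_within_open[OF _ assms(1,2)] assms(3) by metis

lemma Ck_on_cong:
  assumes "open S" "\<And>y. y \<in> S \<Longrightarrow> f y = g y"
  shows "Ck_on k S f \<longleftrightarrow> Ck_on k S g"
  using assms(2)
proof (induction k arbitrary: f g)
  case 0
  then show ?case by (simp cong: continuous_on_cong)
next
  case (Suc k)
  have "f differentiable (at x) \<longleftrightarrow> g differentiable (at x)" if "x \<in> S" for x
    using differentiable_cong_open[OF assms(1) that] Suc.prems by blast
  moreover have "Ck_on k S (\<lambda>x. frechet_derivative f (at x) v)
      \<longleftrightarrow> Ck_on k S (\<lambda>x. frechet_derivative g (at x) v)" for v
    by (rule Suc.IH) (simp add: frechet_derivative_cong_open[OF assms(1) _ Suc.prems])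
  ultimately show ?case by simp
qed

lemma smooth_on_cong:
  assumes "open S" "\<And>y. y \<in> S \<Longrightarrow> f y = g y"
  shows "smooth_on S f \<longleftrightarrow> smooth_on S g"
  unfolding smooth_on_def using Ck_on_cong[of S f g, OF assms] by blast

lemma Ck_on_SucD: "Ck_on (Suc k) S f \<Longrightarrow> Ck_on k S f"
proof (induction k arbitrary: f)
  case 0
  then show ?case
    by (auto intro!: continuous_at_imp_continuous_on differentiable_imp_continuous_within)
next
  case (Suc k)
  then show ?case by auto
qed

lemma smooth_on_differentiable: "smooth_on S f \<Longrightarrow> x \<in> S \<Longrightarrow> f differentiable (at x)"
  unfolding smooth_on_def by (metis Ck_on.simps(2))

lemma smooth_on_has_derivative:
  "smooth_on S f \<Longrightarrow> x \<in> S \<Longrightarrow> (f has_derivative frechet_derivative f (at x)) (at x)"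
  using smooth_on_differentiable frechet_derivative_works by blast

lemma smooth_on_frechet_derivative:
  "smooth_on S f \<Longrightarrow> smooth_on S (\<lambda>x. frechet_derivative f (at x) v)"
  unfolding smooth_on_def by (metis Ck_on.simps(2))

lemma smooth_on_continuous: "smooth_on S f \<Longrightarrow> continuous_on S f"
  unfolding smooth_on_def by (metis Ck_on.simps(1))

lemma Ck_on_const: "Ck_on k S (\<lambda>x. c)"
  by (induction k arbitrary: c) auto

lemma smooth_on_const: "smooth_on S (\<lambda>x. c)"
  by (simp add: smooth_on_def Ck_on_const)

lemma Ck_on_add:
  assumes "open S" "Ck_on k S f" "Ck_on k S g"
  shows "Ck_on k S (\<lambda>x. f x + g x)"
  using assms(2,3)
proof (induction k arbitrary: f g)
  case 0
  then show ?case by (simp add: continuous_on_add)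
next
  case (Suc k)
  have eq: "frechet_derivative (\<lambda>x. f x + g x) (at x) v
      = frechet_derivative f (at x) v + frechet_derivative g (at x) v" if "x \<in> S" for x v
  proof -
    have "((\<lambda>x. f x + g x) has_derivative
        (\<lambda>v. frechet_derivative f (at x) v + frechet_derivative g (at x) v)) (at x)"
      using Suc.prems that
      by (intro has_derivative_add) (auto simp flip: frechet_derivative_works)
    from frechet_derivative_at[OF this, symmetric] show ?thesis by simp
  qed
  have "Ck_on k S (\<lambda>x. frechet_derivative (\<lambda>x. f x + g x) (at x) v)" for v
    using Suc by (subst Ck_on_cong[OF assms(1) eq]) auto
  then show ?case using Suc.prems by auto
qed

lemma smooth_on_add:
  "open S \<Longrightarrow> smooth_on S f \<Longrightarrow> smooth_on S g \<Longrightarrow> smooth_on S (\<lambda>x. f x + g x)"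
  by (simp add: smooth_on_def Ck_on_add)

lemma smooth_on_sum:
  assumes "open S" "\<And>i. i \<in> A \<Longrightarrow> smooth_on S (f i)"
  shows "smooth_on S (\<lambda>x. \<Sum>i\<in>A. f i x)"
  using assms(2)
  by (induction A rule: infinite_finite_induct)
    (auto simp: smooth_on_const intro!: smooth_on_add[OF assms(1)])

text \<open>The product rule turns the \<open>C\<^sup>k\<^sup>+\<^sup>1\<close> case into two \<open>C\<^sup>k\<close> cases.\<close>

lemma Ck_on_bilinear:
  fixes f :: "'a::euclidean_space \<Rightarrow> 'b::euclidean_space"
    and g :: "'a \<Rightarrow> 'c::euclidean_space"
    and h :: "'b \<Rightarrow> 'c \<Rightarrow> 'd::euclidean_space"
  assumes "open S" "bounded_bilinear h" "Ck_on k S f" "Ck_on k S g"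
  shows "Ck_on k S (\<lambda>x. h (f x) (g x))"
  using assms(3,4)
proof (induction k arbitrary: f g)
  case 0
  then show ?case by (simp add: bounded_bilinear.continuous_on[OF assms(2)])
next
  case (Suc k)
  have hd: "((\<lambda>x. h (f x) (g x)) has_derivative
        (\<lambda>v. h (f x) (frechet_derivative g (at x) v)
           + h (frechet_derivative f (at x) v) (g x))) (at x)" if "x \<in> S" for x
    using Suc.prems that
    by (intro bounded_bilinear.FDERIV[OF assms(2)]) (auto simp flip: frechet_derivative_works)
  have eq: "frechet_derivative (\<lambda>x. h (f x) (g x)) (at x) v
      = h (f x) (frechet_derivative g (at x) v)
      + h (frechet_derivative f (at x) v) (g x)" if "x \<in> S" for x v
    using frechet_derivative_at[OF hd[OF that], symmetric] by simp
  have "Ck_on k S (\<lambda>x. frechet_derivative (\<lambda>x. h (f x) (g x)) (at x) v)" for v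
    using Suc Ck_on_SucD[OF Suc.prems(1)] Ck_on_SucD[OF Suc.prems(2)]
    by (subst Ck_on_cong[OF assms(1) eq]) (auto intro!: Ck_on_add assms(1))
  then show ?case using hd by (auto simp: differentiable_def)
qed

lemma smooth_on_scaleR:
  assumes "open S" "smooth_on S f" "smooth_on S g"
  shows "smooth_on S (\<lambda>x. f x *\<^sub>R g x)"
  using Ck_on_bilinear[OF assms(1) bounded_bilinear_scaleR] assms(2,3)
  unfolding smooth_on_def by blast

lemma smooth_on_inner:
  assumes "open S" "smooth_on S f" "smooth_on S g"
  shows "smooth_on S (\<lambda>x. f x \<bullet> g x)"
  using Ck_on_bilinear[OF assms(1) bounded_bilinear_inner] assms(2,3)
  unfolding smooth_on_def by blast

lemma smooth_on_scaleR_const: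
  "open S \<Longrightarrow> smooth_on S f \<Longrightarrow> smooth_on S (\<lambda>x. c *\<^sub>R f x)"
  by (intro smooth_on_scaleR smooth_on_const)

lemma smooth_on_minus: "open S \<Longrightarrow> smooth_on S f \<Longrightarrow> smooth_on S (\<lambda>x. - f x)"
  using smooth_on_scaleR_const[of S f "-1"] by simp

lemma smooth_on_diff:
  "open S \<Longrightarrow> smooth_on S f \<Longrightarrow> smooth_on S g \<Longrightarrow> smooth_on S (\<lambda>x. f x - g x)"
  using smooth_on_add[of S f "\<lambda>x. - g x"] smooth_on_minus[of S g] by simp

lemma set_integrable_continuous_on_compact:
  fixes f :: "'a::euclidean_space \<Rightarrow> real"
  assumes "compact K" "continuous_on K f"
  shows "set_integrable lborel K f"
  using borel_integrable_compact[OF assms] by (simp add: set_integrable_def)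

section \<open>Integration by parts\<close>

text \<open>
  Lebesgue measure is invariant under translations, so the integral of the difference quotient
  \<open>(h (x + s e) - h x) / s\<close> is zero. The derivative is bounded on the compact support, hence
  the difference quotients are dominated and one can let \<open>s\<close> tend to zero.
\<close>

lemma set_integral_partial_derivative_zero:
  fixes h :: "'a::euclidean_space \<Rightarrow> real"
  assumes "open \<Omega>" "compact K" "K \<subseteq> \<Omega>"
    and diff: "\<And>x. x \<in> \<Omega> \<Longrightarrow> h differentiable (at x)"
    and cont: "continuous_on \<Omega> (\<lambda>x. frechet_derivative h (at x) e)"
    and zero: "\<And>x. x \<in> \<Omega> - K \<Longrightarrow> h x = 0"
  shows "(LINT x:K|lborel. frechet_derivative h (at x) e) = 0"
proof -
  (* The extension of h by zero is defined on the whole space, where translations act. *)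
  define g where "g x = (if x \<in> K then h x else 0)" for x
  define g' where "g' x = indicator K x *\<^sub>R frechet_derivative h (at x) e" for x
  have gh: "g x = h x" if "x \<in> \<Omega>" for x
    using that zero by (auto simp: g_def)
  have openK: "open (- K)"
    using assms(2) by (simp add: compact_imp_closed open_Compl)
  have gd: "(g has_derivative frechet_derivative g (at x)) (at x)
      \<and> frechet_derivative g (at x) e = g' x" for x
  proof (cases "x \<in> K")
    case True
    then have x: "x \<in> \<Omega>" using assms(3) by auto
    have "g differentiable (at x)"
      using diff[OF x] differentiable_cong_open[of \<Omega> x g h, OF assms(1) x gh] by blast
    then show ?thesis
      using True frechet_derivative_cong_open[of \<Omega> x g h, OF assms(1) x gh]
      by (simp add: g'_def frechet_derivative_works)
  next
    case False
    have "(g has_derivative (\<lambda>_. 0)) (at x)"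
      by (rule has_derivative_transform_within_open[where f = "\<lambda>_. 0", OF _ openK])
        (use False in \<open>auto simp: g_def\<close>)
    moreover from frechet_derivative_at[OF this] have "frechet_derivative g (at x) = (\<lambda>_. 0)"
      by simp
    ultimately show ?thesis using False by (simp add: g'_def)
  qed
  have gcont: "continuous_on UNIV g"
    using gd has_derivative_continuous by (metis continuous_at_imp_continuous_on)
  have line: "((\<lambda>s. g (x + s *\<^sub>R e)) has_real_derivative g' (x + s *\<^sub>R e)) (at s)" for x s
  proof -
    have "((\<lambda>s. g (x + s *\<^sub>R e)) has_derivative
        (\<lambda>r. frechet_derivative g (at (x + s *\<^sub>R e)) (r *\<^sub>R e))) (at s)"
      by (rule has_derivative_compose[of "\<lambda>s. x + s *\<^sub>R e" _ _ _ g])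
        (use gd in \<open>auto intro!: derivative_eq_intros\<close>)
    moreover have "frechet_derivative g (at (x + s *\<^sub>R e)) (r *\<^sub>R e) = g' (x + s *\<^sub>R e) * r" for r
      using gd[of "x + s *\<^sub>R e"] linear_cmul[OF has_derivative_linear, of g _ "at (x + s *\<^sub>R e)"]
      by (metis mult.commute real_scaleR_def)
    ultimately show ?thesis by (simp add: has_field_derivative_def)
  qed
  have "bounded ((\<lambda>x. frechet_derivative h (at x) e) ` K)"
    using assms(2,3) cont by (meson compact_continuous_image compact_imp_bounded continuous_on_subset)
  then obtain M where M: "0 < M" "\<And>x. x \<in> K \<Longrightarrow> \<bar>frechet_derivative h (at x) e\<bar> \<le> M"
    unfolding bounded_pos by auto
  have g'M: "\<bar>g' x\<bar> \<le> M" for x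
    using M by (auto simp: g'_def indicator_def)
  have lip: "\<bar>g (x + s *\<^sub>R e) - g x\<bar> \<le> M * \<bar>s\<bar>" for x s
  proof -
    have "norm (g (x + s *\<^sub>R e) - g (x + 0 *\<^sub>R e)) \<le> M * norm (s - 0)"
      by (rule field_differentiable_bound[where S = UNIV and f' = "\<lambda>s. g' (x + s *\<^sub>R e)"])
        (use line g'M in auto)
    then show ?thesis by simp
  qed
  obtain R where R: "\<And>x. x \<in> K \<Longrightarrow> norm x \<le> R"
    using compact_imp_bounded[OF assms(2)] by (auto simp: bounded_iff)
  define B where "B = cball (0::'a) (R + norm e)"
  define q where "q n x = real (Suc n) * (g (x + inverse (real (Suc n)) *\<^sub>R e) - g x)" for n x
  have gint: "integrable lborel g"
  proof -
    have "integrable lborel (\<lambda>x. indicator K x *\<^sub>R g x)"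
      by (rule borel_integrable_compact[OF assms(2)]) (use gcont continuous_on_subset in blast)
    moreover have "(\<lambda>x. indicator K x *\<^sub>R g x) = g" by (auto simp: g_def indicator_def)
    ultimately show ?thesis by simp
  qed
  have shift: "integrable lborel (\<lambda>x. g (x + c)) \<and> (LINT x|lborel. g (x + c)) = (LINT x|lborel. g x)" for c
  proof
    have eq: "distr lborel borel ((+) c) = (lborel :: 'a measure)"
      by (rule lborel_distr_plus)
    have m: "g \<in> borel_measurable borel"
      using gcont by (simp add: borel_measurable_continuous_onI)
    show "integrable lborel (\<lambda>x. g (x + c))"
      using gint integrable_distr_eq[of "(+) c" lborel borel g] m eq by (simp add: add.commute)
    show "(LINT x|lborel. g (x + c)) = (LINT x|lborel. g x)"
      using integral_distr[of "(+) c" lborel borel g] m eq by (simp add: add.commute)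
  qed
  have "(LINT x|lborel. q n x) = 0" for n
    unfolding q_def using shift[of "inverse (real (Suc n)) *\<^sub>R e"] gint by simp
  moreover have "(\<lambda>n. LINT x|lborel. q n x) \<longlonglongrightarrow> (LINT x|lborel. g' x)"
  proof (rule integral_dominated_convergence[where w = "\<lambda>x. M * indicator B x"])
    show "g' \<in> borel_measurable lborel"
      using borel_measurable_integrable[OF borel_integrable_compact[OF assms(2),
          of "\<lambda>x. frechet_derivative h (at x) e"]] assms(3) cont continuous_on_subset
      unfolding g'_def by blast
    show "q n \<in> borel_measurable lborel" for n
      unfolding q_def
      by (intro borel_measurable_times borel_measurable_diff borel_measurable_const
          borel_measurable_integrable[OF shift[THEN conjunct1]] borel_measurable_integrable[OF gint])
    show "integrable lborel (\<lambda>x. M * indicator B x :: real)"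
      using borel_integrable_compact[of B "\<lambda>_. M"] by (simp add: B_def mult.commute)
    show "AE x in lborel. (\<lambda>n. q n x) \<longlonglongrightarrow> g' x"
    proof (rule AE_I2)
      fix x
      have "((\<lambda>s. (g (x + s *\<^sub>R e) - g x) / s) \<longlongrightarrow> g' x) (at 0)"
        using line[of x 0] by (simp add: DERIV_def)
      moreover have "filterlim (\<lambda>n. inverse (real (Suc n))) (at 0) sequentially"
        using LIMSEQ_inverse_real_of_nat by (auto simp: filterlim_at)
      ultimately have "(\<lambda>n. (g (x + inverse (real (Suc n)) *\<^sub>R e) - g x) / inverse (real (Suc n)))
          \<longlonglongrightarrow> g' x"
        by (rule filterlim_compose)
      then show "(\<lambda>n. q n x) \<longlonglongrightarrow> g' x"
        unfolding q_def by (simp add: field_simps)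
    qed
    show "AE x in lborel. norm (q n x) \<le> M * indicator B x" for n
    proof (rule AE_I2)
      fix x
      let ?s = "inverse (real (Suc n))"
      show "norm (q n x) \<le> M * indicator B x"
      proof (cases "x \<in> B")
        case True
        have "\<bar>q n x\<bar> = real (Suc n) * \<bar>g (x + ?s *\<^sub>R e) - g x\<bar>"
          unfolding q_def abs_mult by simp
        also have "\<dots> \<le> real (Suc n) * (M * \<bar>?s\<bar>)"
          by (intro mult_left_mono lip) simp
        also have "\<dots> = M" by (simp add: field_simps)
        finally show ?thesis using True by simp
      next
        case False
        then have nx: "R + norm e < norm x" by (simp add: B_def)
        have "norm (?s *\<^sub>R e) \<le> norm e"
          by (simp add: divide_simps distrib_left)
        moreover have "norm x \<le> norm (x + ?s *\<^sub>R e) + norm (?s *\<^sub>R e)"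
          using norm_triangle_ineq4[of "x + ?s *\<^sub>R e" "?s *\<^sub>R e"] by simp
        ultimately have "x \<notin> K" "x + ?s *\<^sub>R e \<notin> K"
          using R[of x] R[of "x + ?s *\<^sub>R e"] nx norm_ge_zero[of e] by linarith+
        then show ?thesis by (simp add: q_def g_def False)
      qed
    qed
  qed
  ultimately have "(LINT x|lborel. g' x) = 0"
    by (simp add: LIMSEQ_const_iff)
  then show ?thesis by (simp add: set_lebesgue_integral_def g'_def)
qed

section \<open>The pull-back connection at a point\<close>

lemma nabla_cong:
  assumes "open S" "x \<in> S" "\<phi> x = \<psi> x" "\<And>y. y \<in> S \<Longrightarrow> V y = W y"
  shows "nabla \<phi> v V x = nabla \<psi> v W x"
  using frechet_derivative_cong_open[of S x V W, OF assms(1,2,4)] assms(3) by (simp add: nabla_def)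

lemma rough_laplacian_cong:
  assumes "open S" "\<And>y. y \<in> S \<Longrightarrow> \<phi> y = \<psi> y" "\<And>y. y \<in> S \<Longrightarrow> V y = W y" "x \<in> S"
  shows "rough_laplacian \<phi> V x = rough_laplacian \<psi> W x"
proof -
  have "nabla \<phi> e (nabla \<phi> e V) x = nabla \<psi> e (nabla \<psi> e W) x" for e
    by (intro nabla_cong[OF assms(1)] assms)
  then show ?thesis by (simp add: rough_laplacian_def)
qed

lemma rough_laplacian_funpow_cong:
  assumes "open S" "\<And>y. y \<in> S \<Longrightarrow> \<phi> y = \<psi> y" "\<And>y. y \<in> S \<Longrightarrow> V y = W y" "x \<in> S"
  shows "(rough_laplacian \<phi> ^^ k) V x = (rough_laplacian \<psi> ^^ k) W x"
  using assms(4)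
proof (induction k arbitrary: x)
  case 0
  then show ?case using assms(3) by simp
next
  case (Suc k)
  then show ?case by (auto intro!: rough_laplacian_cong[OF assms(1)] assms(2))
qed

lemma tension_cong:
  assumes "open S" "\<And>y. y \<in> S \<Longrightarrow> \<phi> y = \<psi> y" "x \<in> S"
  shows "tension \<phi> x = tension \<psi> x"
proof -
  have "frechet_derivative \<phi> (at y) e = frechet_derivative \<psi> (at y) e" if "y \<in> S" for y e
    using frechet_derivative_cong_open[of S y \<phi> \<psi>, OF assms(1) that assms(2)] by simp
  then have "nabla \<phi> e (\<lambda>y. frechet_derivative \<phi> (at y) e) x
      = nabla \<psi> e (\<lambda>y. frechet_derivative \<psi> (at y) e) x" for e
    using assms by (intro nabla_cong[OF assms(1)]) auto
  then show ?thesis by (simp add: tension_def)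
qed

lemma ext_d_cong:
  assumes "open S" "\<And>y. y \<in> S \<Longrightarrow> \<phi> y = \<psi> y" "\<And>y vs. y \<in> S \<Longrightarrow> \<omega> y vs = \<eta> y vs" "x \<in> S"
  shows "ext_d \<phi> \<omega> x vs = ext_d \<psi> \<eta> x vs"
proof -
  have "nabla \<phi> v (\<lambda>y. \<omega> y us) x = nabla \<psi> v (\<lambda>y. \<eta> y us) x" for v us
    by (intro nabla_cong[OF assms(1)] assms)
  then show ?thesis by (simp add: ext_d_def)
qed

lemma codiff_cong:
  assumes "open S" "\<And>y. y \<in> S \<Longrightarrow> \<phi> y = \<psi> y" "\<And>y vs. y \<in> S \<Longrightarrow> \<omega> y vs = \<eta> y vs" "x \<in> S"
  shows "codiff \<phi> \<omega> x vs = codiff \<psi> \<eta> x vs"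
proof -
  have "nabla \<phi> v (\<lambda>y. \<omega> y us) x = nabla \<psi> v (\<lambda>y. \<eta> y us) x" for v us
    by (intro nabla_cong[OF assms(1)] assms)
  then show ?thesis by (simp add: codiff_def)
qed

lemma dirac_cong:
  assumes "open S" "\<And>y. y \<in> S \<Longrightarrow> \<phi> y = \<psi> y" "\<And>y vs. y \<in> S \<Longrightarrow> \<omega> y vs = \<eta> y vs" "x \<in> S"
  shows "dirac \<phi> \<omega> x vs = dirac \<psi> \<eta> x vs"
  by (simp add: dirac_def ext_d_cong[OF assms] codiff_cong[OF assms])

lemma nabla_zero [simp]: "nabla \<phi> v (\<lambda>y. 0) x = 0"
  by (simp add: nabla_def)

lemma nabla_add:
  assumes "V differentiable (at x)" "W differentiable (at x)"
  shows "nabla \<phi> v (\<lambda>y. V y + W y) x = nabla \<phi> v V x + nabla \<phi> v W x"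
proof -
  have "((\<lambda>y. V y + W y) has_derivative
      (\<lambda>v. frechet_derivative V (at x) v + frechet_derivative W (at x) v)) (at x)"
    using assms by (intro has_derivative_add) (auto simp flip: frechet_derivative_works)
  from frechet_derivative_at[OF this, symmetric] show ?thesis
    by (simp add: nabla_def Let_def algebra_simps)
qed

lemma nabla_minus:
  assumes "V differentiable (at x)"
  shows "nabla \<phi> v (\<lambda>y. - V y) x = - nabla \<phi> v V x"
proof -
  have "((\<lambda>y. - V y) has_derivative (\<lambda>v. - frechet_derivative V (at x) v)) (at x)"
    using assms by (intro has_derivative_minus) (auto simp flip: frechet_derivative_works)
  from frechet_derivative_at[OF this, symmetric] show ?thesis
    by (simp add: nabla_def Let_def algebra_simps)
qed

lemma nabla_orthogonal:
  assumes "norm (\<phi> x) = 1"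
  shows "nabla \<phi> v V x \<bullet> \<phi> x = 0"
  using assms by (simp add: nabla_def Let_def inner_diff_left dot_square_norm)

text \<open>
  Metric compatibility. For sections orthogonal to \<open>\<phi>\<close> the normal parts, which the connection
  discards, do not contribute to the inner products.
\<close>

lemma nabla_metric:
  assumes "V differentiable (at x)" "W differentiable (at x)" "V x \<bullet> \<phi> x = 0" "W x \<bullet> \<phi> x = 0"
  shows "frechet_derivative (\<lambda>y. V y \<bullet> W y) (at x) v = nabla \<phi> v V x \<bullet> W x + V x \<bullet> nabla \<phi> v W x"
proof -
  have "((\<lambda>y. V y \<bullet> W y) has_derivative
      (\<lambda>v. V x \<bullet> frechet_derivative W (at x) v + frechet_derivative V (at x) v \<bullet> W x)) (at x)"
    using assms by (intro has_derivative_inner) (auto simp flip: frechet_derivative_works)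
  from frechet_derivative_at[OF this, symmetric] show ?thesis
    using assms(3,4)
    by (simp add: nabla_def Let_def inner_diff_left inner_diff_right inner_commute)
qed

section \<open>Exterior derivatives of sections\<close>

lemma ext_d_section:
  "ext_d \<phi> (form_of_section V) x vs = (if length vs = 1 then nabla \<phi> (hd vs) V x else 0)"
proof -
  consider "vs = []" | v where "vs = [v]" | v w us where "vs = v # w # us"
    by (metis neq_Nil_conv)
  then show ?thesis
  proof cases
    case 3
    have "(\<lambda>y. form_of_section V y (take i vs @ drop (Suc i) vs)) = (\<lambda>y. 0)" for i
      unfolding form_of_section_def using 3 by (cases i) auto
    then have "ext_d \<phi> (form_of_section V) x vs = 0"
      by (simp only: ext_d_def nabla_zero scaleR_zero_right sum.neutral_const)
    then show ?thesis using 3 by simp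
  qed (auto simp: ext_d_def form_of_section_def)
qed

text \<open>The curvature of the pull-back connection, applied to the section \<open>V\<close>.\<close>

definition section_curvature ::
    "('a::euclidean_space \<Rightarrow> 'b::euclidean_space) \<Rightarrow> ('a \<Rightarrow> 'b) \<Rightarrow> ('a, 'b) vform" where
  "section_curvature \<phi> V = ext_d \<phi> (ext_d \<phi> (form_of_section V))"

lemma section_curvature_pair:
  "section_curvature \<phi> V x [v, w] = nabla \<phi> v (nabla \<phi> w V) x - nabla \<phi> w (nabla \<phi> v V) x"
  by (simp add: section_curvature_def ext_d_def[of _ "ext_d _ _"] ext_d_section numeral_2_eq_2)

lemma section_curvature_degree:
  assumes "length vs \<noteq> 2"
  shows "section_curvature \<phi> V x vs = 0"
proof -
  have "length (take i vs @ drop (Suc i) vs) \<noteq> 1" if "i < length vs" for i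
    using assms that by auto
  then show ?thesis
    by (simp add: section_curvature_def ext_d_def[of _ "ext_d _ _"] ext_d_section)
qed

text \<open>
  Since \<open>d\<^sup>*\<close> is zero on sections, the square of \<open>d\<^sup>* + d\<close> is \<open>d\<^sup>*d + d\<^sup>2\<close> there. The curvature \<open>d\<^sup>2\<close>
  is the only source of the difference between the two energies.
\<close>

lemma dirac_section: "dirac \<phi> (form_of_section V) = ext_d \<phi> (form_of_section V)"
  by (intro ext) (simp add: dirac_def codiff_def form_of_section_def)

lemma dirac_dirac_section:
  "dirac \<phi> (dirac \<phi> (form_of_section V)) =
   (\<lambda>x vs. form_of_section (rough_laplacian \<phi> V) x vs + section_curvature \<phi> V x vs)"
  unfolding dirac_section
  by (intro ext) (auto simp: dirac_def codiff_def ext_d_section section_curvature_def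
      form_of_section_def rough_laplacian_def cong: if_cong)

section \<open>Alternating forms\<close>

text \<open>
  Transpositions of neighbours generate all permutations, and for lists of arguments they are
  the easiest to handle.
\<close>

definition alternating_on :: "'a::euclidean_space set \<Rightarrow> ('a, 'b::euclidean_space) vform \<Rightarrow> bool" where
  "alternating_on S \<omega> \<longleftrightarrow>
     (\<forall>x\<in>S. \<forall>us v w ws. \<omega> x (us @ v # w # ws) = - \<omega> x (us @ w # v # ws))"

lemma alternating_onD:
  "alternating_on S \<omega> \<Longrightarrow> x \<in> S \<Longrightarrow> \<omega> x (us @ v # w # ws) = - \<omega> x (us @ w # v # ws)"
  unfolding alternating_on_def by blast

lemma alternating_on_add:
  assumes "alternating_on S \<omega>" "alternating_on S \<eta>"
  shows "alternating_on S (\<lambda>x vs. \<omega> x vs + \<eta> x vs)"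
  unfolding alternating_on_def
proof (intro ballI allI)
  fix x us v w ws
  assume "x \<in> S"
  from alternating_onD[OF assms(1) this, of us v w ws] alternating_onD[OF assms(2) this, of us v w ws]
  show "\<omega> x (us @ v # w # ws) + \<eta> x (us @ v # w # ws)
      = - (\<omega> x (us @ w # v # ws) + \<eta> x (us @ w # v # ws))"
    by simp
qed

lemma nabla_alternating:
  assumes "open S" "alternating_on S \<omega>" "x \<in> S" "\<And>vs. (\<lambda>y. \<omega> y vs) differentiable (at x)"
  shows "nabla \<phi> e (\<lambda>y. \<omega> y (us @ v # w # ws)) x = - nabla \<phi> e (\<lambda>y. \<omega> y (us @ w # v # ws)) x"
proof -
  have "nabla \<phi> e (\<lambda>y. \<omega> y (us @ v # w # ws)) x = nabla \<phi> e (\<lambda>y. - \<omega> y (us @ w # v # ws)) x"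
    by (intro nabla_cong[OF assms(1,3)] alternating_onD[OF assms(2)] refl)
  then show ?thesis using nabla_minus[OF assms(4)] by simp
qed

lemma alternating_on_codiff:
  assumes "open S" "alternating_on S \<omega>" "\<And>x vs. x \<in> S \<Longrightarrow> (\<lambda>y. \<omega> y vs) differentiable (at x)"
  shows "alternating_on S (codiff \<phi> \<omega>)"
  unfolding alternating_on_def
proof (intro ballI allI)
  fix x us v w ws
  assume x: "x \<in> S"
  have "(\<Sum>e\<in>Basis. nabla \<phi> e (\<lambda>y. \<omega> y ((e # us) @ v # w # ws)) x)
      = (\<Sum>e\<in>Basis. - nabla \<phi> e (\<lambda>y. \<omega> y ((e # us) @ w # v # ws)) x)"
    by (intro sum.cong refl nabla_alternating[OF assms(1,2) x assms(3)[OF x]])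
  then show "codiff \<phi> \<omega> x (us @ v # w # ws) = - codiff \<phi> \<omega> x (us @ w # v # ws)"
    by (simp add: codiff_def sum_negf)
qed

text \<open>
  Exchanging two adjacent arguments \<open>v\<close>, \<open>w\<close> changes the sign of each term of \<open>d\<omega>\<close> in which
  both survive, since \<open>\<omega>\<close> is alternating, and it exchanges, up to sign, the two terms in which
  one of them is the direction of differentiation.
\<close>

lemma alternating_on_ext_d:
  fixes \<omega> :: "('a::euclidean_space, 'b::euclidean_space) vform"
  assumes "open S" "alternating_on S \<omega>" "\<And>x vs. x \<in> S \<Longrightarrow> (\<lambda>y. \<omega> y vs) differentiable (at x)"
  shows "alternating_on S (ext_d \<phi> \<omega>)"
  unfolding alternating_on_def
proof (intro ballI allI)
  fix x v w :: 'a and us ws :: "'a list"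
  assume x: "x \<in> S"
  define k where "k = length us"
  define n where "n = Suc (Suc (k + length ws))"
  define T where "T vs i = (- 1) ^ i *\<^sub>R
      nabla \<phi> (vs ! i) (\<lambda>y. \<omega> y (take i vs @ drop (Suc i) vs)) x" for vs i
  let ?a = "us @ v # w # ws" and ?b = "us @ w # v # ws"
  (* The terms k and k + 1 differentiate in the direction of one of the exchanged arguments. *)
  have split: "(\<Sum>i<n. T vs i) = T vs k + (T vs (Suc k) + (\<Sum>i\<in>{..<n} - {k} - {Suc k}. T vs i))"
    for vs
    by (subst sum.remove[of _ k], simp_all add: n_def, subst sum.remove[of _ "Suc k"]) auto
  have "T ?a k = - T ?b (Suc k)" "T ?a (Suc k) = - T ?b k"
    by (simp_all add: T_def k_def nth_append)
  moreover have "T ?a i = - T ?b i" if "i \<in> {..<n} - {k} - {Suc k}" for i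
  proof (cases "i < k")
    case True
    then show ?thesis
      using nabla_alternating[OF assms(1,2) x assms(3), of \<phi> "us ! i" "take i us @ drop (Suc i) us" v w ws] x
      by (simp add: T_def k_def nth_append)
  next
    case False
    with that obtain j where j: "i = Suc (Suc (k + j))"
      by (metis DiffE Suc_lessI insertI1 less_iff_Suc_add linorder_neqE_nat)
    show ?thesis
      using nabla_alternating[OF assms(1,2) x assms(3), of \<phi> "ws ! j" us v w "take j ws @ drop (Suc j) ws"] x
      by (simp add: T_def k_def nth_append j numeral_3_eq_3)
  qed
  ultimately have "(\<Sum>i<n. T ?a i) = - (\<Sum>i<n. T ?b i)"
    unfolding split by (simp add: sum_negf)
  then show "ext_d \<phi> \<omega> x ?a = - ext_d \<phi> \<omega> x ?b"
    by (simp add: ext_d_def T_def n_def k_def)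
qed

section \<open>The pointwise norm of perturbed forms\<close>

lemma form_norm_sq_minus_add:
  fixes \<alpha> \<beta> :: "'a::euclidean_space list \<Rightarrow> 'b::euclidean_space"
  shows "form_norm_sq (\<lambda>vs. - (\<alpha> vs + \<beta> vs)) = form_norm_sq \<alpha> + form_norm_sq \<beta> +
    2 * (\<Sum>vs\<in>{vs. set vs \<subseteq> Basis \<and> length vs \<le> DIM('a)}. (\<alpha> vs \<bullet> \<beta> vs) / fact (length vs))"
proof -
  have "(norm (- (\<alpha> vs + \<beta> vs)))\<^sup>2 / fact (length vs) = (norm (\<alpha> vs))\<^sup>2 / fact (length vs)
      + (norm (\<beta> vs))\<^sup>2 / fact (length vs) + 2 * ((\<alpha> vs \<bullet> \<beta> vs) / fact (length vs))" for vs
    by (simp only: norm_minus_cancel power2_norm_eq_inner inner_add_left inner_add_right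
        inner_commute[of "\<beta> vs" "\<alpha> vs"]) (simp add: add_divide_distrib)
  then show ?thesis
    unfolding form_norm_sq_def by (simp add: sum.distrib sum_distrib_left)
qed

lemma sum_lists_degree_0:
  fixes f :: "'a::euclidean_space list \<Rightarrow> real"
  assumes "\<And>vs. vs \<noteq> [] \<Longrightarrow> f vs = 0"
  shows "(\<Sum>vs\<in>{vs. set vs \<subseteq> Basis \<and> length vs \<le> DIM('a)}. f vs) = f []"
proof -
  have "(\<Sum>vs\<in>{vs. set vs \<subseteq> Basis \<and> length vs \<le> DIM('a)}. f vs) = (\<Sum>vs\<in>{[]}. f vs)"
    using assms finite_lists_length_le[OF finite_Basis] by (intro sum.mono_neutral_right) auto
  then show ?thesis by simp
qed

lemma sum_lists_degree_1:
  fixes f :: "'a::euclidean_space list \<Rightarrow> real"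
  assumes "\<And>vs. length vs \<noteq> 1 \<Longrightarrow> f vs = 0"
  shows "(\<Sum>vs\<in>{vs. set vs \<subseteq> Basis \<and> length vs \<le> DIM('a)}. f vs) = (\<Sum>e\<in>Basis. f [e])"
proof -
  have "(\<Sum>vs\<in>{vs. set vs \<subseteq> Basis \<and> length vs \<le> DIM('a)}. f vs)
      = (\<Sum>vs\<in>(\<lambda>e. [e]) ` Basis. f vs)"
  proof (rule sum.mono_neutral_right)
    show "(\<lambda>e. [e]) ` Basis \<subseteq> {vs. set vs \<subseteq> (Basis::'a set) \<and> length vs \<le> DIM('a)}"
      using DIM_positive[where 'a='a] by (auto simp: Suc_le_eq)
    show "\<forall>vs\<in>{vs. set vs \<subseteq> Basis \<and> length vs \<le> DIM('a)} - (\<lambda>e. [e]) ` Basis. f vs = 0"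
    proof (intro ballI assms notI)
      fix vs
      assume vs: "vs \<in> {vs. set vs \<subseteq> Basis \<and> length vs \<le> DIM('a)} - (\<lambda>e. [e]) ` Basis"
        and "length vs = 1"
      then obtain e where "vs = [e]" by (auto simp: length_Suc_conv)
      then show False using vs by auto
    qed
  qed (simp add: finite_lists_length_le)
  also have "\<dots> = (\<Sum>e\<in>Basis. f [e])"
    by (subst sum.reindex) (auto simp: inj_on_def)
  finally show ?thesis .
qed

text \<open>
  Components of different degrees are orthogonal, so a section only meets the degree zero part
  of a perturbation, and its differential only the degree one part.
\<close>

lemma form_norm_sq_section_add:
  fixes \<beta> :: "'a::euclidean_space list \<Rightarrow> 'b::euclidean_space"
  shows "form_norm_sq (\<lambda>vs. - (form_of_section V x vs + \<beta> vs)) =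
    (norm (V x))\<^sup>2 + 2 * (V x \<bullet> \<beta> []) + form_norm_sq \<beta>"
proof -
  have "form_norm_sq (form_of_section V x) = (norm (V x))\<^sup>2"
    unfolding form_norm_sq_def
    by (subst sum_lists_degree_0) (auto simp: form_of_section_def)
  then show ?thesis
    unfolding form_norm_sq_minus_add
    by (subst sum_lists_degree_0) (auto simp: form_of_section_def)
qed

lemma form_norm_sq_ext_d_section_add:
  fixes \<beta> :: "'a::euclidean_space list \<Rightarrow> 'b::euclidean_space"
  shows "form_norm_sq (\<lambda>vs. - (ext_d \<phi> (form_of_section V) x vs + \<beta> vs)) =
    (\<Sum>e\<in>Basis. (norm (nabla \<phi> e V x))\<^sup>2) + 2 * (\<Sum>e\<in>Basis. nabla \<phi> e V x \<bullet> \<beta> [e]) + form_norm_sq \<beta>"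
proof -
  have "form_norm_sq (ext_d \<phi> (form_of_section V) x) = (\<Sum>e\<in>Basis. (norm (nabla \<phi> e V x))\<^sup>2)"
    unfolding form_norm_sq_def
    by (subst sum_lists_degree_1) (auto simp: ext_d_section)
  then show ?thesis
    unfolding form_norm_sq_minus_add
    by (subst sum_lists_degree_1) (auto simp: ext_d_section)
qed

section \<open>Families of sections along a variation\<close>

locale sphere_variation_on =
  fixes \<Omega> K :: "'a::euclidean_space set" and \<phi> :: "'a \<Rightarrow> 'b::euclidean_space"
    and \<epsilon> :: real and \<Phi> :: "real \<Rightarrow> 'a \<Rightarrow> 'b"
  assumes open_domain: "open \<Omega>" and variation: "sphere_variation \<Omega> K \<phi> \<epsilon> \<Phi>"
begin

abbreviation time_interval :: "real set" where
  "time_interval \<equiv> {-\<epsilon><..<\<epsilon>}"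

text \<open>Smoothness is joint in the time and the point, so that it survives derivatives in both.\<close>

definition smooth_family :: "(real \<Rightarrow> 'a \<Rightarrow> 'c::euclidean_space) \<Rightarrow> bool" where
  "smooth_family V \<longleftrightarrow> smooth_on (time_interval \<times> \<Omega>) (\<lambda>p. V (fst p) (snd p))"

definition section_family :: "(real \<Rightarrow> 'a \<Rightarrow> 'b) \<Rightarrow> bool" where
  "section_family V \<longleftrightarrow> smooth_family V \<and> (\<forall>t\<in>time_interval. \<forall>x\<in>\<Omega>. V t x \<bullet> \<Phi> t x = 0)"

definition form_family :: "(real \<Rightarrow> ('a, 'b) vform) \<Rightarrow> bool" where
  "form_family \<omega> \<longleftrightarrow>
     (\<forall>vs. section_family (\<lambda>t x. \<omega> t x vs)) \<and> (\<forall>t\<in>time_interval. alternating_on \<Omega> (\<omega> t))"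

text \<open>
  The forms that measure how far powers of \<open>d\<^sup>* + d\<close> are from powers of the Laplacian. Vanishing
  at time zero makes products of two of them quadratic in the time, and vanishing off \<open>K\<close>
  removes the boundary terms of partial integrations over \<open>K\<close>.
\<close>

definition vanishing_family :: "(real \<Rightarrow> ('a, 'b) vform) \<Rightarrow> bool" where
  "vanishing_family \<omega> \<longleftrightarrow> form_family \<omega> \<and>
     (\<forall>t\<in>time_interval. \<forall>x\<in>\<Omega> - K. \<forall>vs. \<omega> t x vs = 0) \<and> (\<forall>x\<in>\<Omega>. \<forall>vs. \<omega> 0 x vs = 0)"

lemma
  shows zero_time: "0 \<in> time_interval" and compact_K: "compact K" and K_subset: "K \<subseteq> \<Omega>"
    and smooth_family_\<Phi>: "smooth_family \<Phi>"
    and norm_\<Phi>: "t \<in> time_interval \<Longrightarrow> x \<in> \<Omega> \<Longrightarrow> norm (\<Phi> t x) = 1"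
    and \<Phi>_zero: "x \<in> \<Omega> \<Longrightarrow> \<Phi> 0 x = \<phi> x"
    and \<Phi>_off: "t \<in> time_interval \<Longrightarrow> x \<in> \<Omega> - K \<Longrightarrow> \<Phi> t x = \<Phi> 0 x"
  using variation unfolding sphere_variation_def smooth_family_def case_prod_unfold by auto

lemma open_off: "open (\<Omega> - K)"
  using open_domain compact_K by (simp add: compact_imp_closed open_Diff)

lemma open_cylinder: "open (time_interval \<times> \<Omega>)"
  using open_domain by (simp add: open_Times)

lemma smooth_family_space_derivative:
  assumes "smooth_family V" "t \<in> time_interval" "x \<in> \<Omega>"
  shows "(V t has_derivative (\<lambda>v. frechet_derivative (\<lambda>p. V (fst p) (snd p)) (at (t, x)) (0, v))) (at x)"
proof -
  have "((\<lambda>p. V (fst p) (snd p)) has_derivative frechet_derivative (\<lambda>p. V (fst p) (snd p)) (at (t, x))) (at (t, x))"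
    using assms smooth_on_has_derivative unfolding smooth_family_def by blast
  then show ?thesis
    using has_derivative_compose[of "\<lambda>x. (t, x)" "\<lambda>v. (0, v)" x UNIV "\<lambda>p. V (fst p) (snd p)"]
    by (simp add: has_derivative_Pair)
qed

lemma smooth_family_time_derivative:
  assumes "smooth_family V" "t \<in> time_interval" "x \<in> \<Omega>"
  shows "((\<lambda>t. V t x) has_derivative
    (\<lambda>r. r *\<^sub>R frechet_derivative (\<lambda>p. V (fst p) (snd p)) (at (t, x)) (1, 0))) (at t)"
proof -
  let ?D = "frechet_derivative (\<lambda>p. V (fst p) (snd p)) (at (t, x))"
  have D: "((\<lambda>p. V (fst p) (snd p)) has_derivative ?D) (at (t, x))"
    using assms smooth_on_has_derivative unfolding smooth_family_def by blast
  have "?D (r, 0) = r *\<^sub>R ?D (1, 0)" for r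
    using linear_cmul[OF has_derivative_linear[OF D], of r "(1, 0)"] by simp
  moreover have "((\<lambda>t. V t x) has_derivative (\<lambda>r. ?D (r, 0))) (at t)"
    using D has_derivative_compose[of "\<lambda>t. (t, x)" "\<lambda>r. (r, 0)" t UNIV "\<lambda>p. V (fst p) (snd p)"]
    by (simp add: has_derivative_Pair)
  ultimately show ?thesis
    by (rule has_derivative_eq_rhs[rotated, OF ext])
qed

lemma smooth_family_differentiable:
  "smooth_family V \<Longrightarrow> t \<in> time_interval \<Longrightarrow> x \<in> \<Omega> \<Longrightarrow> V t differentiable (at x)"
  using smooth_family_space_derivative by (auto simp: differentiable_def)

lemma smooth_family_continuous:
  "smooth_family V \<Longrightarrow> t \<in> time_interval \<Longrightarrow> continuous_on \<Omega> (V t)"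
  by (simp add: continuous_at_imp_continuous_on differentiable_imp_continuous_within
      smooth_family_differentiable)

lemma smooth_family_frechet_derivative:
  assumes "smooth_family V"
  shows "smooth_family (\<lambda>t x. frechet_derivative (V t) (at x) v)"
proof -
  let ?D = "\<lambda>p. frechet_derivative (\<lambda>p. V (fst p) (snd p)) (at p) (0, v)"
  have "smooth_on (time_interval \<times> \<Omega>) ?D"
    using assms smooth_on_frechet_derivative unfolding smooth_family_def by blast
  moreover have "smooth_on (time_interval \<times> \<Omega>) ?D
      \<longleftrightarrow> smooth_on (time_interval \<times> \<Omega>) (\<lambda>p. frechet_derivative (V (fst p)) (at (snd p)) v)"
  proof (rule smooth_on_cong[OF open_cylinder])
    fix p
    assume "p \<in> time_interval \<times> \<Omega>"
    then show "?D p = frechet_derivative (V (fst p)) (at (snd p)) v"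
      using frechet_derivative_at[OF smooth_family_space_derivative[OF assms, of "fst p" "snd p"]]
      by (auto simp: fun_eq_iff)
  qed
  ultimately show ?thesis
    unfolding smooth_family_def by simp
qed

lemma smooth_family_zero: "smooth_family (\<lambda>t x. 0)"
  unfolding smooth_family_def by (rule smooth_on_const)

lemma smooth_family_add:
  "smooth_family V \<Longrightarrow> smooth_family W \<Longrightarrow> smooth_family (\<lambda>t x. V t x + W t x)"
  unfolding smooth_family_def by (rule smooth_on_add[OF open_cylinder])

lemma smooth_family_diff:
  "smooth_family V \<Longrightarrow> smooth_family W \<Longrightarrow> smooth_family (\<lambda>t x. V t x - W t x)"
  unfolding smooth_family_def by (rule smooth_on_diff[OF open_cylinder])

lemma smooth_family_minus: "smooth_family V \<Longrightarrow> smooth_family (\<lambda>t x. - V t x)"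
  unfolding smooth_family_def by (rule smooth_on_minus[OF open_cylinder])

lemma smooth_family_sum:
  "(\<And>i. i \<in> A \<Longrightarrow> smooth_family (V i)) \<Longrightarrow> smooth_family (\<lambda>t x. \<Sum>i\<in>A. V i t x)"
  unfolding smooth_family_def by (rule smooth_on_sum[OF open_cylinder])

lemma smooth_family_scaleR:
  "smooth_family f \<Longrightarrow> smooth_family V \<Longrightarrow> smooth_family (\<lambda>t x. f t x *\<^sub>R V t x)"
  unfolding smooth_family_def by (rule smooth_on_scaleR[OF open_cylinder])

lemma smooth_family_scaleR_const: "smooth_family V \<Longrightarrow> smooth_family (\<lambda>t x. c *\<^sub>R V t x)"
  unfolding smooth_family_def by (rule smooth_on_scaleR_const[OF open_cylinder])

lemma smooth_family_inner:
  "smooth_family V \<Longrightarrow> smooth_family W \<Longrightarrow> smooth_family (\<lambda>t x. V t x \<bullet> W t x)"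
  unfolding smooth_family_def by (rule smooth_on_inner[OF open_cylinder])

lemma smooth_family_nabla:
  "smooth_family V \<Longrightarrow> smooth_family (\<lambda>t. nabla (\<Phi> t) v (V t))"
  unfolding nabla_def Let_def
  by (intro smooth_family_diff smooth_family_scaleR smooth_family_inner
      smooth_family_frechet_derivative smooth_family_\<Phi>)

lemma section_family_smooth: "section_family V \<Longrightarrow> smooth_family V"
  by (simp add: section_family_def)

lemma section_family_nabla:
  "smooth_family V \<Longrightarrow> section_family (\<lambda>t. nabla (\<Phi> t) v (V t))"
  by (simp add: section_family_def smooth_family_nabla nabla_orthogonal norm_\<Phi>)

lemma section_family_zero: "section_family (\<lambda>t x. 0)"
  by (simp add: section_family_def smooth_family_zero)

lemma section_family_add:
  "section_family V \<Longrightarrow> section_family W \<Longrightarrow> section_family (\<lambda>t x. V t x + W t x)"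
  by (simp add: section_family_def smooth_family_add inner_add_left)

lemma section_family_minus: "section_family V \<Longrightarrow> section_family (\<lambda>t x. - V t x)"
  by (simp add: section_family_def smooth_family_minus)

lemma section_family_scaleR: "section_family V \<Longrightarrow> section_family (\<lambda>t x. c *\<^sub>R V t x)"
  by (simp add: section_family_def smooth_family_scaleR_const)

lemma section_family_sum:
  "(\<And>i. i \<in> A \<Longrightarrow> section_family (V i)) \<Longrightarrow> section_family (\<lambda>t x. \<Sum>i\<in>A. V i t x)"
  by (simp add: section_family_def smooth_family_sum inner_sum_left)

lemma section_family_tension: "section_family (\<lambda>t. tension (\<Phi> t))"
  unfolding tension_def[abs_def]
  by (intro section_family_sum section_family_nabla smooth_family_frechet_derivative smooth_family_\<Phi>)

lemma section_family_rough_laplacian: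
  "section_family V \<Longrightarrow> section_family (\<lambda>t. rough_laplacian (\<Phi> t) (V t))"
  unfolding rough_laplacian_def[abs_def]
  by (intro section_family_minus section_family_sum section_family_nabla section_family_smooth)

lemma form_family_component: "form_family \<omega> \<Longrightarrow> section_family (\<lambda>t x. \<omega> t x vs)"
  by (simp add: form_family_def)

lemma form_family_differentiable:
  "form_family \<omega> \<Longrightarrow> t \<in> time_interval \<Longrightarrow> x \<in> \<Omega> \<Longrightarrow> (\<lambda>y. \<omega> t y vs) differentiable (at x)"
  using smooth_family_differentiable[OF section_family_smooth[OF form_family_component]] by blast

lemma form_family_zero: "form_family (\<lambda>t x vs. 0)"
  by (simp add: form_family_def section_family_zero alternating_on_def)

lemma form_family_add:
  "form_family \<omega> \<Longrightarrow> form_family \<eta> \<Longrightarrow> form_family (\<lambda>t x vs. \<omega> t x vs + \<eta> t x vs)"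
  by (simp add: form_family_def section_family_add alternating_on_add)

lemma form_family_of_section:
  assumes "section_family V"
  shows "form_family (\<lambda>t. form_of_section (V t))"
proof -
  have "section_family (\<lambda>t x. form_of_section (V t) x vs)" for vs
    using assms by (cases "vs = []") (simp_all add: form_of_section_def section_family_zero)
  then show ?thesis
    by (simp add: form_family_def alternating_on_def form_of_section_def)
qed

lemma form_family_codiff: "form_family \<omega> \<Longrightarrow> form_family (\<lambda>t. codiff (\<Phi> t) (\<omega> t))"
  unfolding form_family_def
proof (intro conjI allI ballI; elim conjE)
  assume \<omega>: "\<forall>vs. section_family (\<lambda>t x. \<omega> t x vs)" "\<forall>t\<in>time_interval. alternating_on \<Omega> (\<omega> t)"
  show "section_family (\<lambda>t x. codiff (\<Phi> t) (\<omega> t) x vs)" for vs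
    unfolding codiff_def using \<omega>
    by (intro section_family_minus section_family_sum section_family_nabla section_family_smooth) simp
  show "alternating_on \<Omega> (codiff (\<Phi> t) (\<omega> t))" if "t \<in> time_interval" for t
    using \<omega> that by (intro alternating_on_codiff open_domain form_family_differentiable)
      (auto simp: form_family_def)
qed

lemma form_family_ext_d: "form_family \<omega> \<Longrightarrow> form_family (\<lambda>t. ext_d (\<Phi> t) (\<omega> t))"
  unfolding form_family_def
proof (intro conjI allI ballI; elim conjE)
  assume \<omega>: "\<forall>vs. section_family (\<lambda>t x. \<omega> t x vs)" "\<forall>t\<in>time_interval. alternating_on \<Omega> (\<omega> t)"
  show "section_family (\<lambda>t x. ext_d (\<Phi> t) (\<omega> t) x vs)" for vs
    unfolding ext_d_def using \<omega>
    by (intro section_family_scaleR section_family_sum section_family_nabla section_family_smooth) simp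
  show "alternating_on \<Omega> (ext_d (\<Phi> t) (\<omega> t))" if "t \<in> time_interval" for t
    using \<omega> that by (intro alternating_on_ext_d open_domain form_family_differentiable)
      (auto simp: form_family_def)
qed

lemma form_family_dirac: "form_family \<omega> \<Longrightarrow> form_family (\<lambda>t. dirac (\<Phi> t) (\<omega> t))"
  unfolding dirac_def by (intro form_family_add form_family_codiff form_family_ext_d)

lemma dirac_zero: "dirac \<psi> (\<lambda>x vs. 0) x vs = 0"
  by (simp add: dirac_def codiff_def ext_d_def)

lemma dirac_add:
  assumes "form_family \<omega>" "form_family \<eta>" "t \<in> time_interval" "x \<in> \<Omega>"
  shows "dirac (\<Phi> t) (\<lambda>y vs. \<omega> t y vs + \<eta> t y vs) x vs
    = dirac (\<Phi> t) (\<omega> t) x vs + dirac (\<Phi> t) (\<eta> t) x vs"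
  using assms
  by (simp add: dirac_def codiff_def ext_d_def nabla_add form_family_differentiable
      sum.distrib scaleR_add_right)

lemma vanishing_family_dirac:
  assumes "vanishing_family \<omega>"
  shows "vanishing_family (\<lambda>t. dirac (\<Phi> t) (\<omega> t))"
proof -
  have "dirac (\<Phi> t) (\<omega> t) x vs = 0" if "t \<in> time_interval" "x \<in> \<Omega> - K" for t x vs
  proof -
    have "dirac (\<Phi> t) (\<omega> t) x vs = dirac (\<Phi> t) (\<lambda>x vs. 0) x vs"
      using assms that by (intro dirac_cong[OF open_off]) (auto simp: vanishing_family_def)
    then show ?thesis by (simp add: dirac_zero)
  qed
  moreover have "dirac (\<Phi> 0) (\<omega> 0) x vs = 0" if "x \<in> \<Omega>" for x vs
  proof -
    have "dirac (\<Phi> 0) (\<omega> 0) x vs = dirac (\<Phi> 0) (\<lambda>x vs. 0) x vs"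
      using assms that by (intro dirac_cong[OF open_domain]) (auto simp: vanishing_family_def)
    then show ?thesis by (simp add: dirac_zero)
  qed
  ultimately show ?thesis
    using assms form_family_dirac by (auto simp: vanishing_family_def)
qed

lemma vanishing_family_add:
  "vanishing_family \<omega> \<Longrightarrow> vanishing_family \<eta> \<Longrightarrow> vanishing_family (\<lambda>t x vs. \<omega> t x vs + \<eta> t x vs)"
  by (simp add: vanishing_family_def form_family_add)

lemma vanishing_family_zero: "vanishing_family (\<lambda>t x vs. 0)"
  by (simp add: vanishing_family_def form_family_zero)

section \<open>The pairing of sections over the support of the variation\<close>

definition pairing :: "(real \<Rightarrow> 'a \<Rightarrow> 'b) \<Rightarrow> (real \<Rightarrow> 'a \<Rightarrow> 'b) \<Rightarrow> real \<Rightarrow> real" where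
  "pairing V W t = (LINT x:K|lborel. V t x \<bullet> W t x)"

lemma set_integrable_smooth_family:
  fixes f :: "real \<Rightarrow> 'a \<Rightarrow> real"
  assumes "smooth_family f" "t \<in> time_interval"
  shows "set_integrable lborel K (f t)"
  using set_integrable_continuous_on_compact[OF compact_K]
    continuous_on_subset[OF smooth_family_continuous[OF assms] K_subset] by blast

lemma set_integrable_pairing:
  "smooth_family V \<Longrightarrow> smooth_family W \<Longrightarrow> t \<in> time_interval \<Longrightarrow> set_integrable lborel K (\<lambda>x. V t x \<bullet> W t x)"
  by (intro set_integrable_smooth_family smooth_family_inner)

lemma pairing_cong:
  assumes "\<And>x. x \<in> \<Omega> \<Longrightarrow> V t x \<bullet> W t x = V' t x \<bullet> W' t x"
  shows "pairing V W t = pairing V' W' t"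
  unfolding pairing_def using compact_K K_subset assms
  by (intro set_lebesgue_integral_cong) (auto intro: borel_compact)

lemma pairing_minus_right: "pairing V (\<lambda>t x. - W t x) t = - pairing V W t"
  by (simp add: pairing_def set_lebesgue_integral_def)

lemma pairing_minus_left: "pairing (\<lambda>t x. - V t x) W t = - pairing V W t"
  by (simp add: pairing_def set_lebesgue_integral_def)

lemma pairing_add_right:
  assumes "smooth_family U" "smooth_family V" "smooth_family W" "t \<in> time_interval"
  shows "pairing U (\<lambda>t x. V t x + W t x) t = pairing U V t + pairing U W t"
  using set_integral_add(2)[OF set_integrable_pairing[OF assms(1,2,4)] set_integrable_pairing[OF assms(1,3,4)]]
  by (simp add: pairing_def inner_add_right)

lemma pairing_diff_left:
  assumes "smooth_family U" "smooth_family V" "smooth_family W" "t \<in> time_interval"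
  shows "pairing (\<lambda>t x. U t x - V t x) W t = pairing U W t - pairing V W t"
  using set_integral_diff(2)[OF set_integrable_pairing[OF assms(1,3,4)] set_integrable_pairing[OF assms(2,3,4)]]
  by (simp add: pairing_def inner_diff_left)

lemma pairing_sum_right:
  assumes "smooth_family V" "\<And>i. i \<in> A \<Longrightarrow> smooth_family (W i)" "t \<in> time_interval"
  shows "pairing V (\<lambda>t x. \<Sum>i\<in>A. W i t x) t = (\<Sum>i\<in>A. pairing V (W i) t)"
  unfolding pairing_def set_lebesgue_integral_def inner_sum_right scaleR_sum_right
  by (intro Bochner_Integration.integral_sum)
    (use set_integrable_pairing assms in \<open>auto simp: set_integrable_def\<close>)

lemma pairing_sum_left:
  assumes "smooth_family V" "\<And>i. i \<in> A \<Longrightarrow> smooth_family (W i)" "t \<in> time_interval"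
  shows "pairing (\<lambda>t x. \<Sum>i\<in>A. W i t x) V t = (\<Sum>i\<in>A. pairing (W i) V t)"
  using pairing_sum_right[OF assms] by (simp add: pairing_def inner_commute)

text \<open>
  The derivative of the inner product of the two sections integrates to zero because the
  second section is supported in \<open>K\<close>.
\<close>

lemma pairing_nabla:
  assumes V: "section_family V" and W: "section_family W"
    and off: "\<And>x. x \<in> \<Omega> - K \<Longrightarrow> W t x = 0" and t: "t \<in> time_interval"
  shows "pairing (\<lambda>t. nabla (\<Phi> t) e (V t)) W t = - pairing V (\<lambda>t. nabla (\<Phi> t) e (W t)) t"
proof -
  note sm = section_family_smooth[OF V] section_family_smooth[OF W]
  have smVW: "smooth_family (\<lambda>t x. V t x \<bullet> W t x)"
    by (intro smooth_family_inner sm)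
  have "0 = (LINT x:K|lborel. frechet_derivative (\<lambda>y. V t y \<bullet> W t y) (at x) e)"
  proof (rule set_integral_partial_derivative_zero[OF open_domain compact_K K_subset, symmetric])
    show "(\<lambda>y. V t y \<bullet> W t y) differentiable (at x)" if "x \<in> \<Omega>" for x
      using smooth_family_differentiable[OF smVW t that] .
    show "continuous_on \<Omega> (\<lambda>x. frechet_derivative (\<lambda>y. V t y \<bullet> W t y) (at x) e)"
      using smooth_family_continuous[OF smooth_family_frechet_derivative[OF smVW] t] .
  qed (simp add: off)
  also have "\<dots> = (LINT x:K|lborel. nabla (\<Phi> t) e (V t) x \<bullet> W t x + V t x \<bullet> nabla (\<Phi> t) e (W t) x)"
  proof (rule set_lebesgue_integral_cong)
    show "\<forall>x. x \<in> K \<longrightarrow> frechet_derivative (\<lambda>y. V t y \<bullet> W t y) (at x) e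
        = nabla (\<Phi> t) e (V t) x \<bullet> W t x + V t x \<bullet> nabla (\<Phi> t) e (W t) x"
      using K_subset V W t smooth_family_differentiable[OF _ t]
      by (auto intro!: nabla_metric simp: section_family_def)
  qed (simp add: borel_compact compact_K)
  also have "\<dots> = pairing (\<lambda>t. nabla (\<Phi> t) e (V t)) W t + pairing V (\<lambda>t. nabla (\<Phi> t) e (W t)) t"
    unfolding pairing_def
    by (intro set_integral_add(2) set_integrable_pairing[of "\<lambda>t. nabla (\<Phi> t) e (V t)" W]
        set_integrable_pairing[of V "\<lambda>t. nabla (\<Phi> t) e (W t)"] smooth_family_nabla sm t)
  finally show ?thesis by simp
qed

section \<open>Quadratic terms have no first variation\<close>

text \<open>
  The mean value inequality in the time direction, where the time derivative is bounded on a
  compact cylinder over \<open>K\<close>.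
\<close>

lemma vanishing_at_zero_linear_bound:
  assumes V: "smooth_family V" and zero: "\<And>x. x \<in> \<Omega> \<Longrightarrow> V 0 x = 0"
  obtains C where "0 \<le> C" "\<And>t x. \<bar>t\<bar> \<le> \<epsilon> / 2 \<Longrightarrow> x \<in> K \<Longrightarrow> norm (V t x) \<le> C * \<bar>t\<bar>"
proof -
  define J where "J = {-\<epsilon> / 2..\<epsilon> / 2}"
  have \<epsilon>: "0 < \<epsilon>" using zero_time by simp
  have J: "J \<subseteq> time_interval" "0 \<in> J" using \<epsilon> by (auto simp: J_def)
  let ?D = "\<lambda>p. frechet_derivative (\<lambda>p. V (fst p) (snd p)) (at p) (1, 0)"
  have "continuous_on (time_interval \<times> \<Omega>) ?D"
    by (intro smooth_on_continuous smooth_on_frechet_derivative V[unfolded smooth_family_def])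
  then have "continuous_on (J \<times> K) ?D"
    by (rule continuous_on_subset) (use J K_subset in auto)
  moreover have "compact (J \<times> K)" by (simp add: J_def compact_Times compact_K)
  ultimately have "bounded (?D ` (J \<times> K))"
    using compact_continuous_image compact_imp_bounded by blast
  then obtain C where C: "0 < C" "\<And>p. p \<in> J \<times> K \<Longrightarrow> norm (?D p) \<le> C"
    unfolding bounded_pos by blast
  have "norm (V t x) \<le> C * \<bar>t\<bar>" if "\<bar>t\<bar> \<le> \<epsilon> / 2" "x \<in> K" for t x
  proof -
    have "norm (V t x - V 0 x) \<le> C * norm (t - 0)"
    proof (rule differentiable_bound[of J "\<lambda>t. V t x" "\<lambda>t r. r *\<^sub>R ?D (t, x)"])
      show "((\<lambda>t. V t x) has_derivative (\<lambda>r. r *\<^sub>R ?D (s, x))) (at s within J)" if "s \<in> J" for s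
        using smooth_family_time_derivative[OF V] J K_subset \<open>x \<in> K\<close> that
        by (meson has_derivative_at_withinI subsetD)
      show "onorm (\<lambda>r. r *\<^sub>R ?D (s, x)) \<le> C" if "s \<in> J" for s
        using C(2)[of "(s, x)"] \<open>x \<in> K\<close> that
        by (intro onorm_le) (simp add: mult.commute[of C] mult_left_mono)
    qed (use J that in \<open>auto simp: J_def\<close>)
    then show ?thesis using zero K_subset that by auto
  qed
  then show ?thesis using that[of C] C(1) by simp
qed

lemma quadratic_bound_deriv_zero:
  fixes F :: "real \<Rightarrow> real"
  assumes "0 < \<delta>" "\<And>t. \<bar>t\<bar> \<le> \<delta> \<Longrightarrow> \<bar>F t\<bar> \<le> C * t\<^sup>2"
  shows "(F has_real_derivative 0) (at 0)"
proof -
  have F0: "F 0 = 0" using assms(2)[of 0] assms(1) by simp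
  have "((\<lambda>h. F h / h) \<longlongrightarrow> 0) (at 0)"
  proof (rule Lim_null_comparison)
    show "\<forall>\<^sub>F h in at 0. norm (F h / h) \<le> C * \<bar>h\<bar>"
      unfolding eventually_at
    proof (intro exI[of _ \<delta>] conjI assms(1) ballI impI)
      fix h :: real
      assume "h \<noteq> 0 \<and> dist h 0 < \<delta>"
      then show "norm (F h / h) \<le> C * \<bar>h\<bar>"
        using assms(2)[of h] by (simp add: field_simps power2_eq_square flip: abs_mult)
    qed
    show "((\<lambda>h. C * \<bar>h\<bar>) \<longlongrightarrow> 0) (at 0)"
      by (auto intro!: tendsto_eq_intros)
  qed
  then show ?thesis by (simp add: DERIV_def F0)
qed

text \<open>Two factors of size \<open>O(t)\<close> uniformly on \<open>K\<close> have a pairing of size \<open>O(t\<^sup>2)\<close>.\<close>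

lemma pairing_deriv_zero:
  assumes V: "smooth_family V" "\<And>x. x \<in> \<Omega> \<Longrightarrow> V 0 x = 0"
    and W: "smooth_family W" "\<And>x. x \<in> \<Omega> \<Longrightarrow> W 0 x = 0"
  shows "(pairing V W has_real_derivative 0) (at 0)"
proof -
  obtain C where C: "0 \<le> C" "\<And>t x. \<bar>t\<bar> \<le> \<epsilon> / 2 \<Longrightarrow> x \<in> K \<Longrightarrow> norm (V t x) \<le> C * \<bar>t\<bar>"
    using vanishing_at_zero_linear_bound[OF V] by blast
  obtain D where D: "0 \<le> D" "\<And>t x. \<bar>t\<bar> \<le> \<epsilon> / 2 \<Longrightarrow> x \<in> K \<Longrightarrow> norm (W t x) \<le> D * \<bar>t\<bar>"
    using vanishing_at_zero_linear_bound[OF W] by blast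
  have \<epsilon>: "0 < \<epsilon>" using zero_time by simp
  show ?thesis
  proof (rule quadratic_bound_deriv_zero)
    show "0 < \<epsilon> / 2" using \<epsilon> by simp
    fix t :: real
    assume t: "\<bar>t\<bar> \<le> \<epsilon> / 2"
    then have tt: "t \<in> time_interval" using \<epsilon> by auto
    have bound: "norm (indicator K x *\<^sub>R (V t x \<bullet> W t x)) \<le> indicator K x *\<^sub>R (C * D * t\<^sup>2)" for x
    proof (cases "x \<in> K")
      case True
      have "\<bar>V t x \<bullet> W t x\<bar> \<le> norm (V t x) * norm (W t x)"
        by (rule Cauchy_Schwarz_ineq2)
      also have "\<dots> \<le> (C * \<bar>t\<bar>) * (D * \<bar>t\<bar>)"
        using C D t True by (intro mult_mono) auto
      also have "\<dots> = C * D * t\<^sup>2"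
        by (simp add: power2_eq_square)
      finally show ?thesis using True by simp
    qed simp
    have "\<bar>pairing V W t\<bar> \<le> (LINT x|lborel. norm (indicator K x *\<^sub>R (V t x \<bullet> W t x)))"
      unfolding pairing_def set_lebesgue_integral_def real_norm_def[symmetric]
      by (rule integral_norm_bound)
    also have "\<dots> \<le> (LINT x|lborel. indicator K x *\<^sub>R (C * D * t\<^sup>2))"
    proof (rule integral_mono)
      show "integrable lborel (\<lambda>x. norm (indicator K x *\<^sub>R (V t x \<bullet> W t x)))"
        using set_integrable_pairing[OF V(1) W(1) tt] unfolding set_integrable_def
        by (rule integrable_norm)
      show "integrable lborel (\<lambda>x. indicator K x *\<^sub>R (C * D * t\<^sup>2))"
        by (rule borel_integrable_compact[OF compact_K]) simp
    qed (rule bound)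
    also have "\<dots> = measure lborel K * C * D * t\<^sup>2"
      by (simp add: mult.assoc)
    finally show "\<bar>pairing V W t\<bar> \<le> measure lborel K * C * D * t\<^sup>2" .
  qed
qed

lemma deriv_zero_cong:
  assumes "(F has_real_derivative 0) (at 0)" "\<And>t. t \<in> time_interval \<Longrightarrow> G t = F t"
  shows "(G has_real_derivative 0) (at 0)"
  using has_field_derivative_transform_within_open[OF assms(1) _ zero_time] assms(2) by simp

lemma deriv_zero_add:
  assumes "(F has_real_derivative 0) (at 0)" "(G has_real_derivative 0) (at 0)"
  shows "((\<lambda>t. F t + G t) has_real_derivative 0) (at 0)"
  using DERIV_add[OF assms] by simp

lemma deriv_zero_sum:
  assumes "\<And>i. i \<in> A \<Longrightarrow> (F i has_real_derivative 0) (at 0)"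
  shows "((\<lambda>t. \<Sum>i\<in>A. F i t) has_real_derivative 0) (at 0)"
  using DERIV_sum[of A "\<lambda>t i. F i t" "\<lambda>_. 0"] assms by simp

end

section \<open>Comparison of the two energies\<close>

context sphere_variation_on
begin

text \<open>
  At time zero the curvature term vanishes not only for \<open>V\<close> but also for its iterated rough
  Laplacians; this makes the notion stable under the rough Laplacian.
\<close>

definition flat_section_family :: "(real \<Rightarrow> 'a \<Rightarrow> 'b) \<Rightarrow> bool" where
  "flat_section_family V \<longleftrightarrow> section_family V \<and>
     (\<forall>t\<in>time_interval. \<forall>x\<in>\<Omega> - K. V t x = V 0 x) \<and>
     (\<forall>k v w. \<forall>x\<in>\<Omega>.
        nabla (\<Phi> 0) v (nabla (\<Phi> 0) w ((rough_laplacian (\<Phi> 0) ^^ k) (V 0))) x =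
        nabla (\<Phi> 0) w (nabla (\<Phi> 0) v ((rough_laplacian (\<Phi> 0) ^^ k) (V 0))) x)"

lemma flat_section_family_commute:
  assumes "flat_section_family V" "x \<in> \<Omega>"
  shows "nabla (\<Phi> 0) v (nabla (\<Phi> 0) w ((rough_laplacian (\<Phi> 0) ^^ k) (V 0))) x =
    nabla (\<Phi> 0) w (nabla (\<Phi> 0) v ((rough_laplacian (\<Phi> 0) ^^ k) (V 0))) x"
  using assms unfolding flat_section_family_def by blast

lemma flat_section_family_off:
  "flat_section_family V \<Longrightarrow> t \<in> time_interval \<Longrightarrow> x \<in> \<Omega> - K \<Longrightarrow> V t x = V 0 x"
  unfolding flat_section_family_def by blast

lemma flat_section_family_section: "flat_section_family V \<Longrightarrow> section_family V"
  by (simp add: flat_section_family_def)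

lemma flat_section_family_rough_laplacian:
  assumes "flat_section_family V"
  shows "flat_section_family (\<lambda>t. rough_laplacian (\<Phi> t) (V t))"
  unfolding flat_section_family_def
proof (intro conjI allI ballI)
  show "section_family (\<lambda>t. rough_laplacian (\<Phi> t) (V t))"
    using assms by (intro section_family_rough_laplacian flat_section_family_section)
  show "rough_laplacian (\<Phi> t) (V t) x = rough_laplacian (\<Phi> 0) (V 0) x"
    if "t \<in> time_interval" "x \<in> \<Omega> - K" for t x
    using that by (intro rough_laplacian_cong[OF open_off] \<Phi>_off flat_section_family_off[OF assms])
  show "nabla (\<Phi> 0) v (nabla (\<Phi> 0) w ((rough_laplacian (\<Phi> 0) ^^ k) (rough_laplacian (\<Phi> 0) (V 0)))) x =
        nabla (\<Phi> 0) w (nabla (\<Phi> 0) v ((rough_laplacian (\<Phi> 0) ^^ k) (rough_laplacian (\<Phi> 0) (V 0)))) x"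
    if "x \<in> \<Omega>" for k v w x
    using flat_section_family_commute[OF assms that, of v w "Suc k"]
    by (simp only: funpow_Suc_right comp_def)
qed

lemma flat_section_family_rough_laplacian_funpow:
  "flat_section_family V \<Longrightarrow> flat_section_family (\<lambda>t. (rough_laplacian (\<Phi> t) ^^ k) (V t))"
  by (induction k) (auto intro: flat_section_family_rough_laplacian)

lemma form_family_curvature:
  "section_family V \<Longrightarrow> form_family (\<lambda>t. section_curvature (\<Phi> t) (V t))"
  unfolding section_curvature_def by (intro form_family_ext_d form_family_of_section)

lemma vanishing_family_curvature:
  assumes "flat_section_family V"
  shows "vanishing_family (\<lambda>t. section_curvature (\<Phi> t) (V t))"
proof -
  have zero: "section_curvature (\<Phi> 0) (V 0) x vs = 0" if "x \<in> \<Omega>" for x vs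
  proof (cases "length vs = 2")
    case True
    then obtain v w where "vs = [v, w]"
      by (auto simp: numeral_2_eq_2 length_Suc_conv)
    then show ?thesis
      using flat_section_family_commute[OF assms that, of v w 0] by (simp add: section_curvature_pair)
  qed (simp add: section_curvature_degree)
  moreover have "section_curvature (\<Phi> t) (V t) x vs = 0" if "t \<in> time_interval" "x \<in> \<Omega> - K" for t x vs
  proof -
    have "form_of_section (V t) y us = form_of_section (V 0) y us" if "y \<in> \<Omega> - K" for y us
      using flat_section_family_off[OF assms \<open>t \<in> time_interval\<close> that] by (simp add: form_of_section_def)
    then have "section_curvature (\<Phi> t) (V t) x vs = section_curvature (\<Phi> 0) (V 0) x vs"
      unfolding section_curvature_def
      using that by (intro ext_d_cong[OF open_off] \<Phi>_off)
    then show ?thesis using zero that by simp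
  qed
  ultimately show ?thesis
    using assms by (simp add: vanishing_family_def form_family_curvature flat_section_family_section)
qed

lemma vanishing_family_component:
  assumes "vanishing_family \<omega>"
  shows "section_family (\<lambda>t x. \<omega> t x vs)" "smooth_family (\<lambda>t x. \<omega> t x vs)"
    "t \<in> time_interval \<Longrightarrow> x \<in> \<Omega> - K \<Longrightarrow> \<omega> t x vs = 0" "x \<in> \<Omega> \<Longrightarrow> \<omega> 0 x vs = 0"
  using assms by (auto simp: vanishing_family_def form_family_def section_family_def)

text \<open>
  The degree zero part of \<open>(d\<^sup>* + d)\<gamma>\<close> is \<open>d\<^sup>*\<close> of the degree one part of \<open>\<gamma>\<close>, and \<open>d\<^sup>*\<close> is the
  adjoint of \<open>d\<close>.
\<close>

lemma pairing_dirac_degree_0: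
  assumes \<sigma>: "section_family \<sigma>" and \<gamma>: "vanishing_family \<gamma>" and t: "t \<in> time_interval"
  shows "pairing \<sigma> (\<lambda>t x. dirac (\<Phi> t) (\<gamma> t) x []) t
    = (\<Sum>e\<in>Basis. pairing (\<lambda>t. nabla (\<Phi> t) e (\<sigma> t)) (\<lambda>t x. \<gamma> t x [e]) t)"
proof -
  note comp = vanishing_family_component[OF \<gamma>]
  have "pairing \<sigma> (\<lambda>t x. dirac (\<Phi> t) (\<gamma> t) x []) t
      = - pairing \<sigma> (\<lambda>t x. \<Sum>e\<in>Basis. nabla (\<Phi> t) e (\<lambda>y. \<gamma> t y [e]) x) t"
    by (simp add: dirac_def codiff_def ext_d_def pairing_minus_right)
  also have "\<dots> = - (\<Sum>e\<in>Basis. pairing \<sigma> (\<lambda>t. nabla (\<Phi> t) e (\<lambda>y. \<gamma> t y [e])) t)"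
    by (subst pairing_sum_right)
      (use t in \<open>simp_all add: section_family_smooth[OF \<sigma>] smooth_family_nabla comp(2)\<close>)
  also have "\<dots> = (\<Sum>e\<in>Basis. pairing (\<lambda>t. nabla (\<Phi> t) e (\<sigma> t)) (\<lambda>t x. \<gamma> t x [e]) t)"
    using pairing_nabla[OF \<sigma> comp(1) comp(3)[OF t] t] by (simp add: sum_negf)
  finally show ?thesis .
qed

text \<open>
  Partial integration pairs the second covariant derivatives of \<open>\<sigma>\<close> with the degree two part
  of \<open>\<gamma>\<close>. As \<open>\<gamma>\<close> is alternating, only their antisymmetric part, half of the curvature term,
  remains.
\<close>

lemma pairing_dirac_degree_1:
  assumes \<sigma>: "section_family \<sigma>" and \<gamma>: "vanishing_family \<gamma>" and t: "t \<in> time_interval"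
  shows "(\<Sum>e\<in>Basis. pairing (\<lambda>t. nabla (\<Phi> t) e (\<sigma> t)) (\<lambda>t x. dirac (\<Phi> t) (\<gamma> t) x [e]) t)
    = pairing (\<lambda>t. rough_laplacian (\<Phi> t) (\<sigma> t)) (\<lambda>t x. \<gamma> t x []) t
      + 1 / 2 * (\<Sum>e\<in>Basis. \<Sum>f\<in>Basis.
          pairing (\<lambda>t x. section_curvature (\<Phi> t) (\<sigma> t) x [f, e]) (\<lambda>t x. \<gamma> t x [f, e]) t)"
proof -
  note comp = vanishing_family_component[OF \<gamma>]
  let ?d = "\<lambda>e. \<lambda>t. nabla (\<Phi> t) e (\<sigma> t)"
  let ?dd = "\<lambda>f e. \<lambda>t. nabla (\<Phi> t) f (nabla (\<Phi> t) e (\<sigma> t))"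
  let ?P = "\<lambda>f e f' e'. pairing (?dd f e) (\<lambda>t x. \<gamma> t x [f', e']) t"
  note sm = section_family_smooth[OF \<sigma>] smooth_family_nabla comp(2) t
  have sec: "section_family (?d e)" for e
    by (intro section_family_nabla sm)
  have "pairing (?d e) (\<lambda>t x. dirac (\<Phi> t) (\<gamma> t) x [e]) t
      = (\<Sum>f\<in>Basis. ?P f e f e) - pairing (?dd e e) (\<lambda>t x. \<gamma> t x []) t" for e
  proof -
    have "pairing (?d e) (\<lambda>t x. dirac (\<Phi> t) (\<gamma> t) x [e]) t = pairing (?d e)
        (\<lambda>t x. - (\<Sum>f\<in>Basis. nabla (\<Phi> t) f (\<lambda>y. \<gamma> t y [f, e]) x) + nabla (\<Phi> t) e (\<lambda>y. \<gamma> t y []) x) t"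
      by (simp add: dirac_def codiff_def ext_d_def)
    also have "\<dots> = - (\<Sum>f\<in>Basis. pairing (?d e) (\<lambda>t. nabla (\<Phi> t) f (\<lambda>y. \<gamma> t y [f, e])) t)
        + pairing (?d e) (\<lambda>t. nabla (\<Phi> t) e (\<lambda>y. \<gamma> t y [])) t"
      by (subst pairing_add_right; (intro sm smooth_family_minus smooth_family_sum)?)
        (subst pairing_minus_right, subst pairing_sum_right; (intro sm)?; simp)
    also have "\<dots> = (\<Sum>f\<in>Basis. ?P f e f e) - pairing (?dd e e) (\<lambda>t x. \<gamma> t x []) t"
      using pairing_nabla[OF sec comp(1) comp(3)[OF t] t] by (simp add: sum_negf)
    finally show ?thesis .
  qed
  then have "(\<Sum>e\<in>Basis. pairing (?d e) (\<lambda>t x. dirac (\<Phi> t) (\<gamma> t) x [e]) t)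
      = (\<Sum>e\<in>Basis. \<Sum>f\<in>Basis. ?P f e f e) - (\<Sum>e\<in>Basis. pairing (?dd e e) (\<lambda>t x. \<gamma> t x []) t)"
    by (simp add: sum_subtractf)
  moreover have "pairing (\<lambda>t. rough_laplacian (\<Phi> t) (\<sigma> t)) (\<lambda>t x. \<gamma> t x []) t
      = - (\<Sum>e\<in>Basis. pairing (?dd e e) (\<lambda>t x. \<gamma> t x []) t)"
    unfolding rough_laplacian_def
    by (subst pairing_minus_left, subst pairing_sum_left; (intro sm)?; simp)
  moreover have "(\<Sum>e\<in>Basis. \<Sum>f\<in>Basis. ?P f e f e) = 1 / 2 * (\<Sum>e\<in>Basis. \<Sum>f\<in>Basis.
      pairing (\<lambda>t x. section_curvature (\<Phi> t) (\<sigma> t) x [f, e]) (\<lambda>t x. \<gamma> t x [f, e]) t)"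
  proof -
    have "pairing (\<lambda>t x. section_curvature (\<Phi> t) (\<sigma> t) x [f, e]) (\<lambda>t x. \<gamma> t x [f, e]) t
        = ?P f e f e + ?P e f e f" for e f
    proof -
      have alt: "\<gamma> t x [f, e] = - \<gamma> t x [e, f]" if "x \<in> \<Omega>" for x
        using alternating_onD[of \<Omega> "\<gamma> t" x "[]" f e "[]"] \<gamma> t that
        by (simp add: vanishing_family_def form_family_def)
      have "?P e f f e = pairing (?dd e f) (\<lambda>t x. - \<gamma> t x [e, f]) t"
        by (rule pairing_cong) (simp add: alt)
      then have "?P e f f e = - ?P e f e f"
        by (simp add: pairing_minus_right)
      then show ?thesis
        unfolding section_curvature_pair
        by (subst pairing_diff_left; (intro sm)?; simp)
    qed
    then have "(\<Sum>e\<in>Basis. \<Sum>f\<in>Basis.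
        pairing (\<lambda>t x. section_curvature (\<Phi> t) (\<sigma> t) x [f, e]) (\<lambda>t x. \<gamma> t x [f, e]) t)
      = (\<Sum>e\<in>Basis. \<Sum>f\<in>Basis. ?P f e f e) + (\<Sum>e\<in>Basis. \<Sum>f\<in>Basis. ?P e f e f)"
      by (simp add: sum.distrib)
    moreover have "(\<Sum>e\<in>Basis. \<Sum>f\<in>Basis. ?P e f e f) = (\<Sum>e\<in>Basis. \<Sum>f\<in>Basis. ?P f e f e)"
      by (rule sum.swap)
    ultimately show ?thesis by simp
  qed
  ultimately show ?thesis by simp
qed

lemma pairing_dirac_degree_1_deriv_zero:
  assumes \<sigma>: "flat_section_family \<sigma>" and \<gamma>: "vanishing_family \<gamma>"
    and zero: "(pairing (\<lambda>t. rough_laplacian (\<Phi> t) (\<sigma> t)) (\<lambda>t x. \<gamma> t x []) has_real_derivative 0) (at 0)"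
  shows "((\<lambda>t. \<Sum>e\<in>Basis. pairing (\<lambda>t. nabla (\<Phi> t) e (\<sigma> t)) (\<lambda>t x. dirac (\<Phi> t) (\<gamma> t) x [e]) t)
    has_real_derivative 0) (at 0)"
proof (rule deriv_zero_cong)
  note c = vanishing_family_component[OF vanishing_family_curvature[OF \<sigma>]]
  note g = vanishing_family_component[OF \<gamma>]
  have "((\<lambda>t. 1 / 2 * (\<Sum>e\<in>Basis. \<Sum>f\<in>Basis.
      pairing (\<lambda>t x. section_curvature (\<Phi> t) (\<sigma> t) x [f, e]) (\<lambda>t x. \<gamma> t x [f, e]) t))
      has_real_derivative 1 / 2 * 0) (at 0)"
    by (intro DERIV_cmult deriv_zero_sum pairing_deriv_zero c g)
  then show "((\<lambda>t. pairing (\<lambda>t. rough_laplacian (\<Phi> t) (\<sigma> t)) (\<lambda>t x. \<gamma> t x []) t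
      + 1 / 2 * (\<Sum>e\<in>Basis. \<Sum>f\<in>Basis.
          pairing (\<lambda>t x. section_curvature (\<Phi> t) (\<sigma> t) x [f, e]) (\<lambda>t x. \<gamma> t x [f, e]) t))
      has_real_derivative 0) (at 0)"
    using deriv_zero_add[OF zero] by simp
qed (rule pairing_dirac_degree_1[OF flat_section_family_section[OF \<sigma>] \<gamma>])

text \<open>The part of \<open>(d\<^sup>* + d)\<^bsup>2k\<^esup>V\<close> beyond the \<open>k\<close>-th power of the rough Laplacian.\<close>

primrec dirac_remainder :: "(real \<Rightarrow> 'a \<Rightarrow> 'b) \<Rightarrow> nat \<Rightarrow> real \<Rightarrow> ('a, 'b) vform" where
  "dirac_remainder V 0 t = (\<lambda>x vs. 0)"
| "dirac_remainder V (Suc k) t =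
     (\<lambda>x vs. dirac (\<Phi> t) (dirac (\<Phi> t) (dirac_remainder V k t)) x vs
        + section_curvature (\<Phi> t) ((rough_laplacian (\<Phi> t) ^^ k) (V t)) x vs)"

lemma vanishing_family_dirac_remainder:
  assumes "flat_section_family V"
  shows "vanishing_family (dirac_remainder V k)"
proof (induction k)
  case 0
  show ?case using vanishing_family_zero by simp
next
  case (Suc k)
  show ?case
    by (simp, intro vanishing_family_add vanishing_family_dirac Suc vanishing_family_curvature
      flat_section_family_rough_laplacian_funpow assms)
qed

lemma dirac_funpow_even:
  assumes V: "flat_section_family V" and t: "t \<in> time_interval" "x \<in> \<Omega>"
  shows "(dirac (\<Phi> t) ^^ (2 * k)) (form_of_section (V t)) x vs
    = form_of_section ((rough_laplacian (\<Phi> t) ^^ k) (V t)) x vs + dirac_remainder V k t x vs"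
  using t(2)
proof (induction k arbitrary: x vs)
  case 0
  then show ?case by simp
next
  case (Suc k)
  let ?s = "\<lambda>t. form_of_section ((rough_laplacian (\<Phi> t) ^^ k) (V t))"
  have fs: "form_family ?s"
    by (intro form_family_of_section flat_section_family_section
        flat_section_family_rough_laplacian_funpow V)
  have fr: "form_family (dirac_remainder V k)"
    using vanishing_family_dirac_remainder[OF V] by (simp add: vanishing_family_def)
  have 1: "dirac (\<Phi> t) ((dirac (\<Phi> t) ^^ (2 * k)) (form_of_section (V t))) y us
      = dirac (\<Phi> t) (?s t) y us + dirac (\<Phi> t) (dirac_remainder V k t) y us" if "y \<in> \<Omega>" for y us
    using dirac_cong[OF open_domain refl Suc.IH that] dirac_add[OF fs fr t(1) that] by simp
  have "(dirac (\<Phi> t) ^^ (2 * Suc k)) (form_of_section (V t)) x vs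
      = dirac (\<Phi> t) (dirac (\<Phi> t) (?s t)) x vs + dirac (\<Phi> t) (dirac (\<Phi> t) (dirac_remainder V k t)) x vs"
    using dirac_cong[OF open_domain refl 1 Suc.prems]
      dirac_add[OF form_family_dirac[OF fs] form_family_dirac[OF fr] t(1) Suc.prems] by simp
  then show ?case by (simp add: dirac_dirac_section)
qed

lemma dirac_funpow_odd:
  assumes V: "flat_section_family V" and t: "t \<in> time_interval" "x \<in> \<Omega>"
  shows "(dirac (\<Phi> t) ^^ Suc (2 * k)) (form_of_section (V t)) x vs
    = ext_d (\<Phi> t) (form_of_section ((rough_laplacian (\<Phi> t) ^^ k) (V t))) x vs
      + dirac (\<Phi> t) (dirac_remainder V k t) x vs"
proof -
  let ?s = "\<lambda>t. form_of_section ((rough_laplacian (\<Phi> t) ^^ k) (V t))"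
  have fs: "form_family ?s"
    by (intro form_family_of_section flat_section_family_section
        flat_section_family_rough_laplacian_funpow V)
  have fr: "form_family (dirac_remainder V k)"
    using vanishing_family_dirac_remainder[OF V] by (simp add: vanishing_family_def)
  have "(dirac (\<Phi> t) ^^ Suc (2 * k)) (form_of_section (V t)) x vs
      = dirac (\<Phi> t) (\<lambda>x vs. ?s t x vs + dirac_remainder V k t x vs) x vs"
    unfolding funpow.simps comp_def
    by (rule dirac_cong[OF open_domain refl dirac_funpow_even[OF V t(1)] t(2)])
  also have "\<dots> = dirac (\<Phi> t) (?s t) x vs + dirac (\<Phi> t) (dirac_remainder V k t) x vs"
    by (rule dirac_add[OF fs fr t])
  finally show ?thesis by (simp add: dirac_section)
qed

text \<open>
  Moving \<open>(d\<^sup>* + d)\<^sup>2\<close> from the remainder to \<open>\<sigma>\<close> replaces \<open>\<sigma>\<close> by its rough Laplacian and \<open>k + 1\<close>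
  by \<open>k\<close>, up to a quadratic error; therefore the induction is over all \<open>\<sigma>\<close>. The curvature term
  in the recursion of the remainder is a two-form and has no degree zero part.
\<close>

lemma pairing_remainder_deriv_zero:
  assumes V: "flat_section_family V" and "flat_section_family \<sigma>"
  shows "(pairing \<sigma> (\<lambda>t x. dirac_remainder V k t x []) has_real_derivative 0) (at 0)"
  using assms(2)
proof (induction k arbitrary: \<sigma>)
  case 0
  then show ?case by (simp add: pairing_def[abs_def])
next
  case (Suc k)
  note van = vanishing_family_dirac_remainder[OF V, of k]
  let ?F = "\<lambda>t. \<Sum>e\<in>Basis. pairing (\<lambda>t. nabla (\<Phi> t) e (\<sigma> t))
      (\<lambda>t x. dirac (\<Phi> t) (dirac_remainder V k t) x [e]) t"
  show ?case
  proof (rule deriv_zero_cong)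
    show "(?F has_real_derivative 0) (at 0)"
      by (intro pairing_dirac_degree_1_deriv_zero Suc van flat_section_family_rough_laplacian)
    show "pairing \<sigma> (\<lambda>t x. dirac_remainder V (Suc k) t x []) t = ?F t" if "t \<in> time_interval" for t
      using pairing_dirac_degree_0[OF flat_section_family_section[OF Suc.prems]
          vanishing_family_dirac[OF van] that]
      by (simp add: section_curvature_degree)
  qed
qed

lemma integral_form_norm_sq_deriv_zero:
  assumes "vanishing_family \<omega>"
  shows "((\<lambda>t. LINT x:K|lborel. form_norm_sq (\<omega> t x)) has_real_derivative 0) (at 0)"
    and "t \<in> time_interval \<Longrightarrow> set_integrable lborel K (\<lambda>x. form_norm_sq (\<omega> t x))"
proof -
  note comp = vanishing_family_component[OF assms]
  let ?L = "{vs. set vs \<subseteq> (Basis::'a set) \<and> length vs \<le> DIM('a)}"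
  have eq: "form_norm_sq (\<omega> t x)
      = (\<Sum>vs\<in>?L. inverse (fact (length vs)) * (\<omega> t x vs \<bullet> \<omega> t x vs))" for t x
    by (simp add: form_norm_sq_def power2_norm_eq_inner field_simps)
  have int: "set_integrable lborel K (\<lambda>x. inverse (fact (length vs)) * (\<omega> t x vs \<bullet> \<omega> t x vs))"
    if "t \<in> time_interval" for t vs
    using set_integrable_pairing[OF comp(2) comp(2) that] by (intro set_integrable_mult_right)
  show "set_integrable lborel K (\<lambda>x. form_norm_sq (\<omega> t x))" if "t \<in> time_interval" for t
    using int[OF that] finite_lists_length_le[OF finite_Basis]
    unfolding eq set_integrable_def scaleR_sum_right by (intro Bochner_Integration.integrable_sum)
  show "((\<lambda>t. LINT x:K|lborel. form_norm_sq (\<omega> t x)) has_real_derivative 0) (at 0)"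
  proof (rule deriv_zero_cong)
    have "((\<lambda>t. inverse (fact (length vs)) * pairing (\<lambda>t x. \<omega> t x vs) (\<lambda>t x. \<omega> t x vs) t)
        has_real_derivative inverse (fact (length vs)) * 0) (at 0)" for vs
      by (intro DERIV_cmult pairing_deriv_zero comp)
    then show "((\<lambda>t. \<Sum>vs\<in>?L. inverse (fact (length vs)) * pairing (\<lambda>t x. \<omega> t x vs) (\<lambda>t x. \<omega> t x vs) t)
        has_real_derivative 0) (at 0)"
      by (intro deriv_zero_sum) simp
    show "(LINT x:K|lborel. form_norm_sq (\<omega> t x))
        = (\<Sum>vs\<in>?L. inverse (fact (length vs)) * pairing (\<lambda>t x. \<omega> t x vs) (\<lambda>t x. \<omega> t x vs) t)"
      if "t \<in> time_interval" for t
    proof -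
      have "(LINT x:K|lborel. form_norm_sq (\<omega> t x))
          = (\<Sum>vs\<in>?L. LINT x:K|lborel. inverse (fact (length vs)) * (\<omega> t x vs \<bullet> \<omega> t x vs))"
        using int[OF that] unfolding eq set_lebesgue_integral_def set_integrable_def scaleR_sum_right
        by (intro Bochner_Integration.integral_sum)
      then show ?thesis by (simp add: pairing_def)
    qed
  qed
qed

lemma set_integral_form_norm_sq_add:
  assumes "set_integrable lborel K f" "set_integrable lborel K g" "set_integrable lborel K h"
    and "\<And>x. x \<in> \<Omega> \<Longrightarrow> F x = f x + 2 * g x + h x"
  shows "(LINT x:K|lborel. F x)
    = (LINT x:K|lborel. f x) + 2 * (LINT x:K|lborel. g x) + ((LINT x:K|lborel. h x) :: real)"
proof -
  have "(LINT x:K|lborel. F x) = (LINT x:K|lborel. f x + 2 * g x + h x)"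
    using assms(4) K_subset compact_K by (intro set_lebesgue_integral_cong) (auto intro: borel_compact)
  then show ?thesis using assms(1-3) by simp
qed

text \<open>
  Expanding the square of \<open>(d\<^sup>* + d)\<^bsup>r-2\<^esup>\<tau>\<close>, the leading part gives the \<open>r\<close>-energy, the remainder
  a quadratic term, and the mixed term is controlled by \<open>pairing_remainder_deriv_zero\<close>, after one
  more partial integration if \<open>r\<close> is odd.
\<close>

lemma energy_difference_deriv_zero:
  assumes r: "2 \<le> r" and flat: "flat_section_family (\<lambda>t. tension (\<Phi> t))"
  shows "((\<lambda>t. ES_r_energy r K (\<Phi> t) - r_energy r K (\<Phi> t)) has_real_derivative 0) (at 0)"
proof -
  define k where "k = r div 2 - 1"
  define V where "V t = (rough_laplacian (\<Phi> t) ^^ k) (tension (\<Phi> t))" for t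
  define R where "R = dirac_remainder (\<lambda>t. tension (\<Phi> t)) k"
  have V: "flat_section_family V"
    unfolding V_def by (intro flat_section_family_rough_laplacian_funpow flat)
  note smV = section_family_smooth[OF flat_section_family_section[OF V]]
  have R: "vanishing_family R"
    unfolding R_def by (intro vanishing_family_dirac_remainder flat)
  have r1: "r \<noteq> 1" using r by simp
  show ?thesis
  proof (cases "even r")
    case True
    then have rk: "r - 2 = 2 * k" using r by (auto simp: k_def)
    show ?thesis
    proof (rule deriv_zero_cong)
      have "((\<lambda>t. 1 / 2 * (LINT x:K|lborel. form_norm_sq (R t x))) has_real_derivative 1 / 2 * 0) (at 0)"
        by (intro DERIV_cmult integral_form_norm_sq_deriv_zero(1) R)
      then show "((\<lambda>t. pairing V (\<lambda>t x. R t x []) t + 1 / 2 * (LINT x:K|lborel. form_norm_sq (R t x)))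
          has_real_derivative 0) (at 0)"
        using pairing_remainder_deriv_zero[OF flat V, of k]
        by (intro deriv_zero_add) (simp_all add: R_def)
    next
      fix t assume t: "t \<in> time_interval"
      have "(LINT x:K|lborel. form_norm_sq (dirac_pow r (\<Phi> t) x))
          = (LINT x:K|lborel. (norm (V t x))\<^sup>2) + 2 * (LINT x:K|lborel. V t x \<bullet> R t x [])
            + (LINT x:K|lborel. form_norm_sq (R t x))"
      proof (rule set_integral_form_norm_sq_add)
        show "set_integrable lborel K (\<lambda>x. (norm (V t x))\<^sup>2)"
          unfolding power2_norm_eq_inner by (rule set_integrable_pairing[OF smV smV t])
        show "set_integrable lborel K (\<lambda>x. V t x \<bullet> R t x [])"
          by (rule set_integrable_pairing[OF smV vanishing_family_component(2)[OF R] t])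
        show "set_integrable lborel K (\<lambda>x. form_norm_sq (R t x))"
          by (rule integral_form_norm_sq_deriv_zero(2)[OF R t])
        show "form_norm_sq (dirac_pow r (\<Phi> t) x)
            = (norm (V t x))\<^sup>2 + 2 * (V t x \<bullet> R t x []) + form_norm_sq (R t x)" if "x \<in> \<Omega>" for x
          using dirac_funpow_even[OF flat t that, of k] r1
          by (simp add: dirac_pow_def rk V_def R_def flip: form_norm_sq_section_add)
      qed
      then show "ES_r_energy r K (\<Phi> t) - r_energy r K (\<Phi> t)
          = pairing V (\<lambda>t x. R t x []) t + 1 / 2 * (LINT x:K|lborel. form_norm_sq (R t x))"
        using True by (simp add: ES_r_energy_def r_energy_def Let_def pairing_def V_def k_def add_divide_distrib)
    qed
  next
    case False
    then have rk: "r - 2 = Suc (2 * k)" using r by (auto simp: k_def elim!: oddE)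
    let ?Q = "\<lambda>t. dirac (\<Phi> t) (R t)"
    have Q: "vanishing_family ?Q" by (rule vanishing_family_dirac[OF R])
    show ?thesis
    proof (rule deriv_zero_cong)
      have "((\<lambda>t. 1 / 2 * (LINT x:K|lborel. form_norm_sq (?Q t x))) has_real_derivative 1 / 2 * 0) (at 0)"
        by (intro DERIV_cmult integral_form_norm_sq_deriv_zero(1) Q)
      then show "((\<lambda>t. (\<Sum>e\<in>Basis. pairing (\<lambda>t. nabla (\<Phi> t) e (V t)) (\<lambda>t x. ?Q t x [e]) t)
          + 1 / 2 * (LINT x:K|lborel. form_norm_sq (?Q t x))) has_real_derivative 0) (at 0)"
        using pairing_remainder_deriv_zero[OF flat flat_section_family_rough_laplacian[OF V], of k]
        by (intro deriv_zero_add pairing_dirac_degree_1_deriv_zero V R) (simp_all add: R_def)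
    next
      fix t assume t: "t \<in> time_interval"
      have smd: "smooth_family (\<lambda>t. nabla (\<Phi> t) e (V t))" for e
        by (intro smooth_family_nabla smV)
      have int: "set_integrable lborel K (\<lambda>x. nabla (\<Phi> t) e (V t) x \<bullet> ?Q t x [e])" for e
        by (rule set_integrable_pairing[OF smd vanishing_family_component(2)[OF Q] t])
      have "(LINT x:K|lborel. form_norm_sq (dirac_pow r (\<Phi> t) x))
          = (LINT x:K|lborel. (\<Sum>e\<in>Basis. (norm (nabla (\<Phi> t) e (V t) x))\<^sup>2))
            + 2 * (LINT x:K|lborel. (\<Sum>e\<in>Basis. nabla (\<Phi> t) e (V t) x \<bullet> ?Q t x [e]))
            + (LINT x:K|lborel. form_norm_sq (?Q t x))"
      proof (rule set_integral_form_norm_sq_add)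
        show "set_integrable lborel K (\<lambda>x. \<Sum>e\<in>Basis. (norm (nabla (\<Phi> t) e (V t) x))\<^sup>2)"
          using set_integrable_pairing[OF smd smd t]
          unfolding power2_norm_eq_inner set_integrable_def scaleR_sum_right
          by (intro Bochner_Integration.integrable_sum)
        show "set_integrable lborel K (\<lambda>x. \<Sum>e\<in>Basis. nabla (\<Phi> t) e (V t) x \<bullet> ?Q t x [e])"
          using int unfolding set_integrable_def scaleR_sum_right
          by (intro Bochner_Integration.integrable_sum)
        show "set_integrable lborel K (\<lambda>x. form_norm_sq (?Q t x))"
          by (rule integral_form_norm_sq_deriv_zero(2)[OF Q t])
        show "form_norm_sq (dirac_pow r (\<Phi> t) x) = (\<Sum>e\<in>Basis. (norm (nabla (\<Phi> t) e (V t) x))\<^sup>2)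
            + 2 * (\<Sum>e\<in>Basis. nabla (\<Phi> t) e (V t) x \<bullet> ?Q t x [e]) + form_norm_sq (?Q t x)"
          if "x \<in> \<Omega>" for x
          using dirac_funpow_odd[OF flat t that, of k] r1
          by (simp add: dirac_pow_def rk V_def R_def flip: form_norm_sq_ext_d_section_add)
      qed
      moreover have "(LINT x:K|lborel. (\<Sum>e\<in>Basis. nabla (\<Phi> t) e (V t) x \<bullet> ?Q t x [e]))
          = (\<Sum>e\<in>Basis. pairing (\<lambda>t. nabla (\<Phi> t) e (V t)) (\<lambda>t x. ?Q t x [e]) t)"
        using int unfolding pairing_def set_lebesgue_integral_def set_integrable_def scaleR_sum_right
        by (intro Bochner_Integration.integral_sum)
      ultimately show "ES_r_energy r K (\<Phi> t) - r_energy r K (\<Phi> t)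
          = (\<Sum>e\<in>Basis. pairing (\<lambda>t. nabla (\<Phi> t) e (V t)) (\<lambda>t x. ?Q t x [e]) t)
            + 1 / 2 * (LINT x:K|lborel. form_norm_sq (?Q t x))"
        using False by (simp add: ES_r_energy_def r_energy_def Let_def V_def k_def add_divide_distrib)
    qed
  qed
qed

end

text \<open>
  The hypothesis says that the curvature of the pull-back connection annihilates all the
  sections \<open>\<Delta>\<^sup>k\<tau>\<close>.
\<close>

theorem r_harmonic_on_iff_ES_r_harmonic_on:
  fixes \<phi> :: "'a::euclidean_space \<Rightarrow> 'b::euclidean_space"
  assumes "open \<Omega>" "2 \<le> r"
    and flat: "\<And>k v w x. x \<in> \<Omega> \<Longrightarrow>
      nabla \<phi> v (nabla \<phi> w ((rough_laplacian \<phi> ^^ k) (tension \<phi>))) x =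
      nabla \<phi> w (nabla \<phi> v ((rough_laplacian \<phi> ^^ k) (tension \<phi>))) x"
  shows "r_harmonic_on r \<Omega> \<phi> \<longleftrightarrow> ES_r_harmonic_on r \<Omega> \<phi>"
proof -
  have "((\<lambda>t. r_energy r K (\<Phi> t)) has_real_derivative 0) (at 0)
      \<longleftrightarrow> ((\<lambda>t. ES_r_energy r K (\<Phi> t)) has_real_derivative 0) (at 0)"
    if "sphere_variation \<Omega> K \<phi> \<epsilon> \<Phi>" for K \<epsilon> \<Phi>
  proof -
    interpret sphere_variation_on \<Omega> K \<phi> \<epsilon> \<Phi>
      using assms(1) that by unfold_locales
    have rl: "(rough_laplacian (\<Phi> 0) ^^ k) (tension (\<Phi> 0)) y = (rough_laplacian \<phi> ^^ k) (tension \<phi>) y"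
      if "y \<in> \<Omega>" for k y
      by (rule rough_laplacian_funpow_cong[OF open_domain \<Phi>_zero tension_cong[OF open_domain \<Phi>_zero] that])
    have nn: "nabla (\<Phi> 0) v (nabla (\<Phi> 0) w ((rough_laplacian (\<Phi> 0) ^^ k) (tension (\<Phi> 0)))) x =
        nabla \<phi> v (nabla \<phi> w ((rough_laplacian \<phi> ^^ k) (tension \<phi>))) x" if "x \<in> \<Omega>" for k v w x
      using that by (intro nabla_cong[OF open_domain] \<Phi>_zero rl)
    have "flat_section_family (\<lambda>t. tension (\<Phi> t))"
      unfolding flat_section_family_def
    proof (intro conjI allI ballI)
      show "section_family (\<lambda>t. tension (\<Phi> t))" by (rule section_family_tension)
      show "tension (\<Phi> t) x = tension (\<Phi> 0) x" if "t \<in> time_interval" "x \<in> \<Omega> - K" for t x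
        using that by (intro tension_cong[OF open_off] \<Phi>_off)
      show "nabla (\<Phi> 0) v (nabla (\<Phi> 0) w ((rough_laplacian (\<Phi> 0) ^^ k) (tension (\<Phi> 0)))) x =
          nabla (\<Phi> 0) w (nabla (\<Phi> 0) v ((rough_laplacian (\<Phi> 0) ^^ k) (tension (\<Phi> 0)))) x"
        if "x \<in> \<Omega>" for k v w x
        unfolding nn[OF that] by (rule flat[OF that])
    qed
    from energy_difference_deriv_zero[OF assms(2) this]
    have D: "((\<lambda>t. ES_r_energy r K (\<Phi> t) - r_energy r K (\<Phi> t)) has_real_derivative 0) (at 0)" .
    show ?thesis
    proof
      assume "((\<lambda>t. r_energy r K (\<Phi> t)) has_real_derivative 0) (at 0)"
      from DERIV_add[OF D this] show "((\<lambda>t. ES_r_energy r K (\<Phi> t)) has_real_derivative 0) (at 0)"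
        by simp
    next
      assume "((\<lambda>t. ES_r_energy r K (\<Phi> t)) has_real_derivative 0) (at 0)"
      from DERIV_diff[OF this D] show "((\<lambda>t. r_energy r K (\<Phi> t)) has_real_derivative 0) (at 0)"
        by simp
    qed
  qed
  then show ?thesis
    unfolding r_harmonic_on_def ES_r_harmonic_on_def critical_point_def by blast
qed

section \<open>Homogeneous radial fields\<close>

lemma inverse_norm_power_has_derivative:
  fixes x :: "'a::euclidean_space"
  assumes "x \<noteq> 0"
  shows "((\<lambda>y. inverse (norm y) ^ k) has_derivative
    (\<lambda>v. - real k * inverse (norm x) ^ (k + 2) * (x \<bullet> v))) (at x)"
proof -
  have n: "(norm has_derivative (\<lambda>v. inverse (norm x) * (x \<bullet> v))) (at x)"
    using has_derivative_norm[OF assms] by (simp add: sgn_div_norm inner_commute)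
  have "((\<lambda>y. inverse (norm y)) has_derivative
      (\<lambda>v. - (inverse (norm x) * (inverse (norm x) * (x \<bullet> v)) * inverse (norm x)))) (at x)"
    using assms by (intro Deriv.has_derivative_inverse n) simp
  from has_derivative_power[OF this, of k] show ?thesis
  proof (rule has_derivative_eq_rhs)
    show "(\<lambda>y. of_nat k * - (inverse (norm x) * (inverse (norm x) * (x \<bullet> y)) * inverse (norm x)) *
          inverse (norm x) ^ (k - 1)) = (\<lambda>v. - real k * inverse (norm x) ^ (k + 2) * (x \<bullet> v))"
      by (cases k) (simp_all add: fun_eq_iff algebra_simps)
  qed
qed

text \<open>
  The field \<open>|x|\<^bsup>-k\<^esup>(\<alpha> x/|x|, \<beta>)\<close>. The maps into parallel hyperspheres and all the sections
  derived from them below have this form.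
\<close>

definition radial_field :: "real \<Rightarrow> real \<Rightarrow> nat \<Rightarrow> 'a::euclidean_space \<Rightarrow> 'a \<times> real" where
  "radial_field \<alpha> \<beta> k x = ((\<alpha> * inverse (norm x) ^ Suc k) *\<^sub>R x, \<beta> * inverse (norm x) ^ k)"

lemma radial_field_has_derivative:
  fixes x :: "'a::euclidean_space"
  assumes "x \<noteq> 0"
  shows "(radial_field \<alpha> \<beta> k has_derivative (\<lambda>v.
      (\<alpha> *\<^sub>R (inverse (norm x) ^ Suc k *\<^sub>R v
         - (real (Suc k) * inverse (norm x) ^ (k + 3) * (x \<bullet> v)) *\<^sub>R x),
       - (\<beta> * real k * inverse (norm x) ^ (k + 2) * (x \<bullet> v))))) (at x)"
proof -
  have "((\<lambda>y. ((\<alpha> * inverse (norm y) ^ Suc k) *\<^sub>R y, \<beta> * inverse (norm y) ^ k)) has_derivative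
      (\<lambda>v. ((\<alpha> * inverse (norm x) ^ Suc k) *\<^sub>R v
             + (\<alpha> * (- real (Suc k) * inverse (norm x) ^ (Suc k + 2) * (x \<bullet> v))) *\<^sub>R x,
            \<beta> * (- real k * inverse (norm x) ^ (k + 2) * (x \<bullet> v))))) (at x)"
    by (intro has_derivative_Pair has_derivative_scaleR has_derivative_mult_right
        has_derivative_ident inverse_norm_power_has_derivative assms)
  then have "(radial_field \<alpha> \<beta> k has_derivative
      (\<lambda>v. ((\<alpha> * inverse (norm x) ^ Suc k) *\<^sub>R v
             + (\<alpha> * (- real (Suc k) * inverse (norm x) ^ (Suc k + 2) * (x \<bullet> v))) *\<^sub>R x,
            \<beta> * (- real k * inverse (norm x) ^ (k + 2) * (x \<bullet> v))))) (at x)"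
    by (simp only: radial_field_def[abs_def])
  then show ?thesis
    by (rule has_derivative_eq_rhs) (simp add: fun_eq_iff algebra_simps numeral_3_eq_3)
qed

lemma radial_field_second_derivative:
  fixes x :: "'a::euclidean_space"
  assumes "x \<noteq> 0"
  shows "((\<lambda>y. frechet_derivative (radial_field \<alpha> \<beta> k) (at y) w) has_derivative (\<lambda>v.
      (\<alpha> *\<^sub>R ((real (Suc k) * real (k + 3) * inverse (norm x) ^ (k + 5) * (x \<bullet> v) * (x \<bullet> w)
               - real (Suc k) * inverse (norm x) ^ (k + 3) * (v \<bullet> w)) *\<^sub>R x
             - (real (Suc k) * inverse (norm x) ^ (k + 3) * (x \<bullet> w)) *\<^sub>R v
             - (real (Suc k) * inverse (norm x) ^ (k + 3) * (x \<bullet> v)) *\<^sub>R w),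
       \<beta> * (real k * real (k + 2) * inverse (norm x) ^ (k + 4) * (x \<bullet> v) * (x \<bullet> w)
            - real k * inverse (norm x) ^ (k + 2) * (v \<bullet> w))))) (at x)"
proof -
  have inn: "((\<lambda>y. y \<bullet> w) has_derivative (\<lambda>v. v \<bullet> w)) (at x)"
    by (rule has_derivative_inner_left[OF has_derivative_ident])
  have "((\<lambda>y. (\<alpha> *\<^sub>R (inverse (norm y) ^ Suc k *\<^sub>R w
         - (real (Suc k) * (inverse (norm y) ^ (k + 3) * (y \<bullet> w))) *\<^sub>R y),
       - (\<beta> * (real k * (inverse (norm y) ^ (k + 2) * (y \<bullet> w)))))) has_derivative
     (\<lambda>v. (\<alpha> *\<^sub>R ((- real (Suc k) * inverse (norm x) ^ (Suc k + 2) * (x \<bullet> v)) *\<^sub>R w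
         - ((real (Suc k) * (inverse (norm x) ^ (k + 3) * (x \<bullet> w))) *\<^sub>R v
            + (real (Suc k) * (inverse (norm x) ^ (k + 3) * (v \<bullet> w)
                + (- real (k + 3) * inverse (norm x) ^ (k + 3 + 2) * (x \<bullet> v)) * (x \<bullet> w))) *\<^sub>R x)),
       - (\<beta> * (real k * (inverse (norm x) ^ (k + 2) * (v \<bullet> w)
            + (- real (k + 2) * inverse (norm x) ^ (k + 2 + 2) * (x \<bullet> v)) * (x \<bullet> w))))))) (at x)"
    by (intro has_derivative_Pair has_derivative_scaleR has_derivative_mult_right
        has_derivative_scaleR_left has_derivative_scaleR_right has_derivative_diff has_derivative_minus
        has_derivative_mult inn has_derivative_ident inverse_norm_power_has_derivative assms)
  then have "((\<lambda>y. frechet_derivative (radial_field \<alpha> \<beta> k) (at y) w) has_derivative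
     (\<lambda>v. (\<alpha> *\<^sub>R ((- real (Suc k) * inverse (norm x) ^ (Suc k + 2) * (x \<bullet> v)) *\<^sub>R w
         - ((real (Suc k) * (inverse (norm x) ^ (k + 3) * (x \<bullet> w))) *\<^sub>R v
            + (real (Suc k) * (inverse (norm x) ^ (k + 3) * (v \<bullet> w)
                + (- real (k + 3) * inverse (norm x) ^ (k + 3 + 2) * (x \<bullet> v)) * (x \<bullet> w))) *\<^sub>R x)),
       - (\<beta> * (real k * (inverse (norm x) ^ (k + 2) * (v \<bullet> w)
            + (- real (k + 2) * inverse (norm x) ^ (k + 2 + 2) * (x \<bullet> v)) * (x \<bullet> w))))))) (at x)"
  proof (rule has_derivative_transform_within_open[where s = "- {0}"])
    fix y :: 'a assume "y \<in> - {0}"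
    then have "y \<noteq> 0" by simp
    from frechet_derivative_at[OF radial_field_has_derivative[OF this], symmetric]
    show "(\<alpha> *\<^sub>R (inverse (norm y) ^ Suc k *\<^sub>R w
         - (real (Suc k) * (inverse (norm y) ^ (k + 3) * (y \<bullet> w))) *\<^sub>R y),
       - (\<beta> * (real k * (inverse (norm y) ^ (k + 2) * (y \<bullet> w))))) =
       frechet_derivative (radial_field \<alpha> \<beta> k) (at y) w"
      by (simp add: mult.assoc)
  qed (use assms in auto)
  then show ?thesis
    by (rule has_derivative_eq_rhs)
      (simp add: fun_eq_iff algebra_simps eval_nat_numeral)
qed

text \<open>
  Under the condition \<open>\<alpha>p + \<beta>q = 0\<close> the field is orthogonal to the map \<open>(p x/|x|, q)\<close>. It is also
  orthogonal to the derivatives of the map, which are of the form \<open>(w, 0)\<close> with \<open>w\<close> orthogonal to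
  \<open>x\<close>. Hence its derivatives are orthogonal to the map, and the projection in the connection
  does nothing.
\<close>

lemma nabla_radial_field:
  fixes x :: "'a::euclidean_space"
  assumes "x \<noteq> 0" "\<alpha> * p + \<beta> * q = 0"
  shows "nabla (radial_field p q 0) v (radial_field \<alpha> \<beta> k) x
    = frechet_derivative (radial_field \<alpha> \<beta> k) (at x) v"
proof -
  let ?N = "inverse (norm x)"
  have xx: "x \<bullet> x = norm x ^ 2" by (simp add: power2_norm_eq_inner)
  have "frechet_derivative (radial_field \<alpha> \<beta> k) (at x) v \<bullet> radial_field p q 0 x
      = - real k * ?N ^ (k + 2) * (x \<bullet> v) * (\<alpha> * p + \<beta> * q)"
    unfolding frechet_derivative_at[OF radial_field_has_derivative[OF assms(1)], symmetric]
    using assms(1)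
    by (simp add: radial_field_def inner_Pair inner_diff_left xx inner_commute[of v]
        field_simps eval_nat_numeral)
  then show ?thesis using assms(2) by (simp add: nabla_def Let_def)
qed

lemma nabla_nabla_radial_field:
  fixes x :: "'a::euclidean_space"
  assumes "x \<noteq> 0" "\<alpha> * p + \<beta> * q = 0"
  shows "nabla (radial_field p q 0) v (nabla (radial_field p q 0) w (radial_field \<alpha> \<beta> k)) x
    = nabla (radial_field p q 0) v (\<lambda>y. frechet_derivative (radial_field \<alpha> \<beta> k) (at y) w) x"
proof -
  have "frechet_derivative (nabla (radial_field p q 0) w (radial_field \<alpha> \<beta> k)) (at x)
      = frechet_derivative (\<lambda>y. frechet_derivative (radial_field \<alpha> \<beta> k) (at y) w) (at x)"
    by (rule frechet_derivative_cong_open[of "- {0}"]) (use assms nabla_radial_field in auto)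
  then show ?thesis by (simp add: nabla_def)
qed

text \<open>
  The curvature term vanishes: by the previous lemma both sides are projections of second
  derivatives, which are symmetric.
\<close>

lemma nabla_commute_radial_field:
  fixes x :: "'a::euclidean_space"
  assumes "x \<noteq> 0" "\<alpha> * p + \<beta> * q = 0"
  shows "nabla (radial_field p q 0) v (nabla (radial_field p q 0) w (radial_field \<alpha> \<beta> k)) x
    = nabla (radial_field p q 0) w (nabla (radial_field p q 0) v (radial_field \<alpha> \<beta> k)) x"
proof -
  have "frechet_derivative (\<lambda>y. frechet_derivative (radial_field \<alpha> \<beta> k) (at y) w) (at x) v
      = frechet_derivative (\<lambda>y. frechet_derivative (radial_field \<alpha> \<beta> k) (at y) v) (at x) w"
    unfolding frechet_derivative_at[OF radial_field_second_derivative[OF assms(1)], symmetric]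
    by (simp add: algebra_simps inner_commute)
  then show ?thesis
    unfolding nabla_nabla_radial_field[OF assms] by (simp add: nabla_def)
qed

lemma sum_second_derivative_radial_field:
  fixes x :: "'a::euclidean_space"
  assumes "x \<noteq> 0"
  shows "(\<Sum>e\<in>Basis. frechet_derivative (\<lambda>y. frechet_derivative (radial_field \<alpha> \<beta> k) (at y) e) (at x) e)
    = radial_field (\<alpha> * (real (Suc k) * (real k + 1 - real DIM('a)))) (\<beta> * (real k * (real k + 2 - real DIM('a)))) (k + 2) x"
proof -
  let ?N = "inverse (norm x)"
  have N: "?N ^ (m + 2) * (norm x)\<^sup>2 = ?N ^ m" for m
    using assms by (simp add: field_simps power2_eq_square)
  have sq: "(\<Sum>e\<in>Basis. (x \<bullet> e) * (x \<bullet> e)) = (norm x)\<^sup>2"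
    by (simp add: euclidean_inner[of x x] power2_norm_eq_inner)
  have rep: "(\<Sum>e\<in>Basis. (x \<bullet> e) *\<^sub>R e) = x"
    by (rule euclidean_representation)
  have 1: "(\<Sum>e\<in>Basis. (real (Suc k) * real (k + 3) * ?N ^ (k + 5) * (x \<bullet> e) * (x \<bullet> e)
               - real (Suc k) * ?N ^ (k + 3) * (e \<bullet> e)) *\<^sub>R x
             - (real (Suc k) * ?N ^ (k + 3) * (x \<bullet> e)) *\<^sub>R e
             - (real (Suc k) * ?N ^ (k + 3) * (x \<bullet> e)) *\<^sub>R e)
     = (real (Suc k) * (real k + 1 - real DIM('a)) * ?N ^ (k + 3)) *\<^sub>R x" (is "?L = ?R")
  proof -
    have c: "(\<Sum>e\<in>Basis. (c * (x \<bullet> e)) *\<^sub>R e) = c *\<^sub>R x" for c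
    proof -
      have "(\<Sum>e\<in>Basis. (c * (x \<bullet> e)) *\<^sub>R e) = c *\<^sub>R (\<Sum>e\<in>Basis. (x \<bullet> e) *\<^sub>R e)"
        by (simp add: scaleR_sum_right)
      then show ?thesis by (simp only: rep)
    qed
    have "?L = (real (Suc k) * real (k + 3) * ?N ^ (k + 5) * (\<Sum>e\<in>Basis. (x \<bullet> e) * (x \<bullet> e))
        - real (Suc k) * ?N ^ (k + 3) * real DIM('a)) *\<^sub>R x
        - (real (Suc k) * ?N ^ (k + 3)) *\<^sub>R x - (real (Suc k) * ?N ^ (k + 3)) *\<^sub>R x"
      unfolding sum_subtractf c scaleR_sum_left[symmetric]
      by (simp add: sum_distrib_left mult.assoc)
    also have "\<dots> = ?R"
    proof -
      have "?N ^ (k + 5) * (norm x)\<^sup>2 = ?N ^ (k + 3)"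
        using N[of "k + 3"] by (simp add: eval_nat_numeral)
      then have "real (Suc k) * real (k + 3) * ?N ^ (k + 5) * (norm x)\<^sup>2
          = real (Suc k) * real (k + 3) * ?N ^ (k + 3)"
        by (simp only: mult.assoc)
      then show ?thesis
        unfolding sq scaleR_left_diff_distrib[symmetric] by (simp add: algebra_simps)
    qed
    finally show ?thesis .
  qed
  have 2: "(\<Sum>e\<in>Basis. real k * real (k + 2) * ?N ^ (k + 4) * (x \<bullet> e) * (x \<bullet> e)
            - real k * ?N ^ (k + 2) * (e \<bullet> e))
     = real k * (real k + 2 - real DIM('a)) * ?N ^ (k + 2)" (is "?L = ?R")
  proof -
    have "?L = real k * real (k + 2) * ?N ^ (k + 4) * (\<Sum>e\<in>Basis. (x \<bullet> e) * (x \<bullet> e))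
        - real k * ?N ^ (k + 2) * real DIM('a)"
      by (simp add: sum_subtractf sum_distrib_left mult.assoc inner_same_Basis)
    also have "\<dots> = ?R"
    proof -
      have "?N ^ (k + 4) * (norm x)\<^sup>2 = ?N ^ (k + 2)"
        using N[of "k + 2"] by (simp add: eval_nat_numeral)
      then have "real k * real (k + 2) * ?N ^ (k + 4) * (norm x)\<^sup>2
          = real k * real (k + 2) * ?N ^ (k + 2)"
        by (simp only: mult.assoc)
      then show ?thesis
        unfolding sq by (simp add: algebra_simps)
    qed
    finally show ?thesis .
  qed
  have "(\<Sum>e\<in>Basis. frechet_derivative (\<lambda>y. frechet_derivative (radial_field \<alpha> \<beta> k) (at y) e) (at x) e)
    = (\<alpha> *\<^sub>R ((real (Suc k) * (real k + 1 - real DIM('a)) * ?N ^ (k + 3)) *\<^sub>R x),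
       \<beta> * (real k * (real k + 2 - real DIM('a)) * ?N ^ (k + 2)))"
    unfolding frechet_derivative_at[OF radial_field_second_derivative[OF assms], symmetric]
      sum_prod scaleR_sum_right[symmetric] sum_distrib_left[symmetric] 1 2 ..
  then show ?thesis
    by (simp add: radial_field_def numeral_3_eq_3 algebra_simps)
qed

text \<open>
  The tangential projection stays among the radial fields of degree \<open>-k\<close> because the map itself
  is a radial field of degree zero.
\<close>

lemma radial_field_projection:
  fixes x :: "'a::euclidean_space" and \<alpha> \<beta> p q :: real
  assumes "x \<noteq> 0" and s: "s = \<alpha> * p + \<beta> * q"
  shows "radial_field \<alpha> \<beta> k x - (radial_field \<alpha> \<beta> k x \<bullet> radial_field p q 0 x) *\<^sub>R radial_field p q 0 x
    = radial_field (\<alpha> - s * p) (\<beta> - s * q) k x"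
proof -
  have "radial_field \<alpha> \<beta> k x \<bullet> radial_field p q 0 x = s * inverse (norm x) ^ k"
    using assms(1) by (simp add: radial_field_def inner_Pair s field_simps flip: power2_norm_eq_inner)
      (simp add: power2_eq_square algebra_simps)
  then show ?thesis
    by (simp add: radial_field_def algebra_simps)
qed

text \<open>
  With \<open>\<alpha> = p\<close>, \<open>\<beta> = q\<close>, \<open>k = 0\<close> the sum is the tension field of the map; for fields orthogonal to
  the map it is minus the rough Laplacian.
\<close>

lemma sum_nabla_second_derivative_radial_field:
  fixes \<alpha> \<beta> p q :: real and k :: nat
  assumes "p\<^sup>2 + q\<^sup>2 = 1"
  shows "\<exists>\<gamma> \<delta>. \<gamma> * p + \<delta> * q = 0 \<and> (\<forall>x::'a::euclidean_space. x \<noteq> 0 \<longrightarrow>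
    (\<Sum>e\<in>Basis. nabla (radial_field p q 0) e
        (\<lambda>y. frechet_derivative (radial_field \<alpha> \<beta> k) (at y) e) x) = radial_field \<gamma> \<delta> (k + 2) x)"
proof -
  define \<alpha>' where "\<alpha>' = \<alpha> * (real (Suc k) * (real k + 1 - real DIM('a)))"
  define \<beta>' where "\<beta>' = \<beta> * (real k * (real k + 2 - real DIM('a)))"
  define s where "s = \<alpha>' * p + \<beta>' * q"
  have "(\<Sum>e\<in>Basis. nabla (radial_field p q 0) e
        (\<lambda>y. frechet_derivative (radial_field \<alpha> \<beta> k) (at y) e) x)
      = radial_field (\<alpha>' - s * p) (\<beta>' - s * q) (k + 2) x" if "x \<noteq> 0" for x :: 'a
  proof -
    have "(\<Sum>e\<in>Basis. nabla (radial_field p q 0) e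
        (\<lambda>y. frechet_derivative (radial_field \<alpha> \<beta> k) (at y) e) x)
      = (\<Sum>e\<in>Basis. frechet_derivative (\<lambda>y. frechet_derivative (radial_field \<alpha> \<beta> k) (at y) e) (at x) e)
      - ((\<Sum>e\<in>Basis. frechet_derivative (\<lambda>y. frechet_derivative (radial_field \<alpha> \<beta> k) (at y) e) (at x) e)
          \<bullet> radial_field p q 0 x) *\<^sub>R radial_field p q 0 x"
      by (simp add: nabla_def Let_def sum_subtractf inner_sum_left scaleR_sum_left)
    then show ?thesis
      unfolding sum_second_derivative_radial_field[OF that]
      by (subst (asm) radial_field_projection[OF that refl]) (simp add: \<alpha>'_def \<beta>'_def s_def)
  qed
  moreover have "(\<alpha>' - s * p) * p + (\<beta>' - s * q) * q = 0"
  proof -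
    have "(\<alpha>' - s * p) * p + (\<beta>' - s * q) * q = s - s * (p\<^sup>2 + q\<^sup>2)"
      by (simp add: s_def algebra_simps power2_eq_square)
    then show ?thesis by (simp add: assms)
  qed
  ultimately show ?thesis by blast
qed

section \<open>The maps into parallel hyperspheres\<close>

lemma tension_radial_field:
  fixes p q :: real
  assumes "p\<^sup>2 + q\<^sup>2 = 1"
  shows "\<exists>\<gamma> \<delta>. \<gamma> * p + \<delta> * q = 0 \<and> (\<forall>x::'a::euclidean_space. x \<noteq> 0 \<longrightarrow>
    tension (radial_field p q 0) x = radial_field \<gamma> \<delta> 2 x)"
  using sum_nabla_second_derivative_radial_field[OF assms, where \<alpha> = p and \<beta> = q and k = 0]
  by (simp only: tension_def add_0)

lemma rough_laplacian_radial_field: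
  fixes \<alpha> \<beta> p q :: real
  assumes "p\<^sup>2 + q\<^sup>2 = 1" "\<alpha> * p + \<beta> * q = 0"
  shows "\<exists>\<gamma> \<delta>. \<gamma> * p + \<delta> * q = 0 \<and> (\<forall>x::'a::euclidean_space. x \<noteq> 0 \<longrightarrow>
    rough_laplacian (radial_field p q 0) (radial_field \<alpha> \<beta> k) x = radial_field \<gamma> \<delta> (k + 2) x)"
proof -
  obtain \<gamma> \<delta> where 1: "\<gamma> * p + \<delta> * q = 0" and
    2: "\<And>x::'a. x \<noteq> 0 \<Longrightarrow> (\<Sum>e\<in>Basis. nabla (radial_field p q 0) e
        (\<lambda>y. frechet_derivative (radial_field \<alpha> \<beta> k) (at y) e) x) = radial_field \<gamma> \<delta> (k + 2) x"
    using sum_nabla_second_derivative_radial_field[OF assms(1)] by blast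
  have "rough_laplacian (radial_field p q 0) (radial_field \<alpha> \<beta> k) x
      = radial_field (- \<gamma>) (- \<delta>) (k + 2) x" if "x \<noteq> 0" for x :: 'a
    unfolding rough_laplacian_def nabla_nabla_radial_field[OF that assms(2)] 2[OF that]
    by (simp add: radial_field_def)
  moreover have "- \<gamma> * p + - \<delta> * q = 0" using 1 by simp
  ultimately show ?thesis by blast
qed

lemma rough_laplacian_funpow_tension_radial_field:
  fixes p q :: real
  assumes "p\<^sup>2 + q\<^sup>2 = 1"
  shows "\<exists>\<gamma> \<delta> m. \<gamma> * p + \<delta> * q = 0 \<and> (\<forall>x::'a::euclidean_space. x \<noteq> 0 \<longrightarrow>
    (rough_laplacian (radial_field p q 0) ^^ k) (tension (radial_field p q 0)) x = radial_field \<gamma> \<delta> m x)"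
proof (induction k)
  case 0
  show ?case unfolding funpow_0 using tension_radial_field[OF assms, where 'a = 'a] by blast
next
  case (Suc k)
  then obtain \<gamma> \<delta> m where *: "\<gamma> * p + \<delta> * q = 0"
    "\<And>x::'a. x \<noteq> 0 \<Longrightarrow> (rough_laplacian (radial_field p q 0) ^^ k) (tension (radial_field p q 0)) x
      = radial_field \<gamma> \<delta> m x"
    by blast
  have "(rough_laplacian (radial_field p q 0) ^^ Suc k) (tension (radial_field p q 0)) x
      = rough_laplacian (radial_field p q 0) (radial_field \<gamma> \<delta> m) x" if "x \<noteq> 0" for x :: 'a
    unfolding funpow.simps comp_def
    by (rule rough_laplacian_cong[of "- {0}"]) (use that *(2) in auto)
  then show ?case
    using rough_laplacian_radial_field[OF assms *(1), of m, where 'a = 'a] by metis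
qed

lemma nabla_commute_tension_radial_field:
  fixes x :: "'a::euclidean_space" and p q :: real
  defines "\<phi> \<equiv> radial_field p q 0 :: 'a \<Rightarrow> 'a \<times> real"
  assumes "p\<^sup>2 + q\<^sup>2 = 1" "x \<noteq> 0"
  shows "nabla \<phi> v (nabla \<phi> w ((rough_laplacian \<phi> ^^ k) (tension \<phi>))) x
    = nabla \<phi> w (nabla \<phi> v ((rough_laplacian \<phi> ^^ k) (tension \<phi>))) x"
proof -
  obtain \<gamma> \<delta> m where *: "\<gamma> * p + \<delta> * q = 0"
    "\<And>x. x \<noteq> 0 \<Longrightarrow> (rough_laplacian \<phi> ^^ k) (tension \<phi>) x = radial_field \<gamma> \<delta> m x"
    using rough_laplacian_funpow_tension_radial_field[OF assms(2), of k, where 'a = 'a]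
    unfolding \<phi>_def by blast
  have eq: "nabla \<phi> v (nabla \<phi> w ((rough_laplacian \<phi> ^^ k) (tension \<phi>))) x
      = nabla \<phi> v (nabla \<phi> w (radial_field \<gamma> \<delta> m)) x" for v w
    using assms(3) * by (intro nabla_cong[of "- {0}"]) auto
  show ?thesis
    unfolding eq unfolding \<phi>_def by (rule nabla_commute_radial_field[OF assms(3) *(1)])
qed

lemma phi_map_eq_radial_field: "phi_map a = radial_field (sin a) (cos a) 0"
  by (simp add: fun_eq_iff phi_map_def radial_field_def)

theorem proposition1p4:
  fixes r :: nat and a :: real
  assumes "2 \<le> r" and "2 * r + 1 \<le> CARD('n::finite)" and "0 < a" and "a < pi / 2"
  shows "weakly_r_harmonic r (phi_map a :: real ^ 'n \<Rightarrow> (real ^ 'n) \<times> real) \<longleftrightarrow>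
         weakly_ES_r_harmonic r (phi_map a :: real ^ 'n \<Rightarrow> (real ^ 'n) \<times> real)"
proof -
  have "r_harmonic_on r (ball 0 1 - {0}) (phi_map a :: real ^ 'n \<Rightarrow> (real ^ 'n) \<times> real) \<longleftrightarrow>
        ES_r_harmonic_on r (ball 0 1 - {0}) (phi_map a :: real ^ 'n \<Rightarrow> (real ^ 'n) \<times> real)"
    unfolding phi_map_eq_radial_field
    by (intro r_harmonic_on_iff_ES_r_harmonic_on assms(1) nabla_commute_tension_radial_field)
      (auto simp: open_Diff)
  then show ?thesis
    by (simp add: weakly_r_harmonic_def weakly_ES_r_harmonic_def)
qed

end
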